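(* In the setting of maximal cuts described in the context, let $\boldsymbol{\Delta}(\varepsilon)\in\mathrm{GL}(N,\mathbb{K}(\varepsilon))$ be the cohomology intersection matrix computed in the canonical bases, and let $\rho$ be the representation of the Lie algebra $\mathfrak{g}_{\mathbb{A}}$ associated with the system. If the representation $\rho$ of $\mathfrak{g}_{\mathbb{A}}$ is both self-dual (i.e. equivalent to its dual representation $\rho^*=-\rho^T$) and irreducible, then $$\boldsymbol{\Delta}(\varepsilon)=f(\varepsilon)\,\boldsymbol{\Delta}_0,$$ where $f\in\mathbb{K}(\varepsilon)$ is a rational function of $\varepsilon$ and $\boldsymbol{\Delta}_0\in\mathrm{GL}(N,\mathbb{K})$ is either symmetric or antisymmetric.
   Context: Functions and forms. $\mathbb{K}$ is an algebraic number field. $\boldsymbol{x}=(x_1,\dots,x_r)$ are local coordinates and $\mathrm{d}=\sum_k \mathrm{d}x_k\,\partial_{x_k}$ (acting on $\boldsymbol{x}$ only; $\varepsilon$ is a parameter). $\mathcal{A}$ is a $\mathbb{K}$-algebra of functions of $\boldsymbol{x}$, closed under all $\partial_{x_k}$, whose constants are exactly $\mathbb{K}$. $\Omega^1(\mathcal{A})$ is the $\mathbb{K}$-vector space of one-forms $\sum_k \mathrm{d}x_k f_k$, $f_k\in\mathcal{A}$; $Z^1(\mathcal{A})$ is its subspace of closed forms and $Z^2(\mathcal{A})$ the space of closed two-forms with coefficients in $\mathcal{A}$. $\mathcal{A}_\varepsilon=\mathcal{A}\otimes_{\mathbb{K}}\mathbb{K}(\varepsilon)$ and $\mathcal{F}_{\mathbb{C}}=\mathrm{Frac}(\mathbb{C}\otimes_{\mathbb{K}}\mathcal{A})$.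 Setting (maximal cuts of Feynman integrals, viewed as periods of a twisted cohomology theory). $\boldsymbol{P}(\boldsymbol{x},\varepsilon)$ and $\check{\boldsymbol{P}}(\boldsymbol{x},\varepsilon)$ are the invertible $N\times N$ twisted period matrix of the maximal cuts and its dual, $\boldsymbol{C}(\boldsymbol{x},\varepsilon)$ is the invertible cohomology intersection matrix (rational in $\boldsymbol{x}$) and $\boldsymbol{H}(\varepsilon)$ the invertible, $\boldsymbol{x}$-independent homology intersection matrix; they satisfy $(2\pi i)^{-n}\boldsymbol{P}(\boldsymbol{H}^{-1})^T\check{\boldsymbol{P}}^T=\boldsymbol{C}$ for a fixed integer $n$. For maximal cuts the dual bases are chosen such that $\check{\boldsymbol{P}}(\boldsymbol{x},\varepsilon)=\boldsymbol{P}(\boldsymbol{x},-\varepsilon)$. One works in canonical bases for both the integrals and their duals: there are invertible matrices $\boldsymbol{S}(\boldsymbol{x},\varepsilon),\check{\boldsymbol{S}}(\boldsymbol{x},\varepsilon)$ such that $\boldsymbol{G}=\boldsymbol{S}^{-1}\boldsymbol{P}$ and $\check{\boldsymbol{G}}=\check{\boldsymbol{S}}^{-1}\check{\boldsymbol{P}}$ satisfy $$\mathrm{d}\boldsymbol{G}=\varepsilon\boldsymbol{A}(\boldsymbol{x})\boldsymbol{G},\qquad \mathrm{d}\check{\boldsymbol{G}}=\varepsilon\check{\boldsymbol{A}}(\boldsymbol{x})\check{\boldsymbol{G}},$$ where $\boldsymbol{A},\check{\boldsymbol{A}}$ are $N\times N$ matrices with entries in $Z^1(\mathcal{A})$ and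 $\boldsymbol{A}\wedge\boldsymbol{A}=0=\check{\boldsymbol{A}}\wedge\check{\boldsymbol{A}}$; for maximal cuts, $\check{\boldsymbol{A}}(\boldsymbol{x})=-\boldsymbol{A}(\boldsymbol{x})$. The systems are in C-form: the finite-dimensional $\mathbb{K}$-subspace $\mathbb{A}\subseteq Z^1(\mathcal{A})$ generated by the entries of $\boldsymbol{A}$ satisfies $\mathbb{A}\cap\mathrm{d}\mathcal{F}_{\mathbb{C}}=\{0\}$. The intersection matrix in these bases is $\boldsymbol{\Delta}=\boldsymbol{S}^{-1}\boldsymbol{C}(\check{\boldsymbol{S}}^{-1})^T\in\mathrm{GL}(N,\mathcal{A}_\varepsilon)$; it satisfies $\mathrm{d}\boldsymbol{\Delta}=\varepsilon\boldsymbol{A}\boldsymbol{\Delta}+\varepsilon\boldsymbol{\Delta}\check{\boldsymbol{A}}^T$. In this setting $\mathrm{d}\boldsymbol{\Delta}=0$, so $\boldsymbol{\Delta}$ is independent of $\boldsymbol{x}$, has entries in $\mathbb{K}(\varepsilon)$, and is denoted $\boldsymbol{\Delta}(\varepsilon)$. Lie algebra and representation. Let $\omega_1,\dots,\omega_p$ be a basis of $\mathbb{A}$ and write $\boldsymbol{A}(\boldsymbol{x})=\sum_{i=1}^p\boldsymbol{A}_i\omega_i$ with $\boldsymbol{A}_i\in\mathbb{K}^{N\times N}$. Let $\eta_1,\dots,\eta_q\in Z^2(\mathcal{A})$ be linearly independent over $\mathbb{K}$ with $\omega_i\wedge\omega_j=\sum_{k=1}^q a_{ijk}\eta_k$, $a_{ijk}\in\mathbb{K}$.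 $\mathfrak{g}_{\mathbb{A}}$ is the quotient of the free Lie algebra over $\mathbb{K}$ on $t_1,\dots,t_p$ by the Lie ideal generated by $\sum_{i,j=1}^p a_{ijk}[t_i,t_j]$, $1\le k\le q$. The representation associated with the system is $\rho:\mathfrak{g}_{\mathbb{A}}\to\mathrm{End}(\mathbb{C}^N)$, $t_i\mapsto\boldsymbol{A}_i$. Two representations $\rho_1,\rho_2$ are equivalent if $\rho_2=\boldsymbol{M}\rho_1\boldsymbol{M}^{-1}$ for some invertible matrix $\boldsymbol{M}$. The dual representation is $\rho^*=-\rho^T$, and $\rho$ is self-dual if $\rho$ and $\rho^*$ are equivalent. $\rho$ is reducible if there is $\boldsymbol{M}\in\mathrm{GL}(N,\mathbb{C})$ such that $\boldsymbol{M}\rho\boldsymbol{M}^{-1}$ is block upper-triangular, and irreducible otherwise. *)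

theory Defs
  imports "HOL-Analysis.Analysis" "HOL-Computational_Algebra.Normalized_Fraction"
begin

type_synonym ('a, 'n) sq_matrix = "(('a, 'n) vec, 'n) vec"

text \<open>An algebraic number field, given together with its embedding into the complex numbers.\<close>

definition number_field :: "complex set \<Rightarrow> bool" where
  "number_field K \<longleftrightarrow>
     1 \<in> K \<and> (\<forall>a\<in>K. \<forall>b\<in>K. a - b \<in> K \<and> a * b \<in> K) \<and> (\<forall>a\<in>K. inverse a \<in> K) \<and>
     (\<exists>B. finite B \<and> K = {\<Sum>b\<in>B. of_rat (c b) * b | c. True})"

text \<open>\<open>ratfuns K\<close> is the field \<open>K(\<epsilon>)\<close> inside the field of rational functions over the complex
  numbers, and \<open>rat_value f e v\<close> says that \<open>f\<close> has no pole at \<open>e\<close> and takes the value \<open>v\<close> there.\<close>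

definition ratfuns :: "complex set \<Rightarrow> complex poly fract set" where
  "ratfuns K = {Fraction_Field.Fract p q | p q.
                  q \<noteq> 0 \<and> (\<forall>i. coeff p i \<in> K) \<and> (\<forall>i. coeff q i \<in> K)}"

definition rat_const :: "complex \<Rightarrow> complex poly fract" where
  "rat_const c = Fraction_Field.Fract [:c:] 1"

definition rat_value :: "complex poly fract \<Rightarrow> complex \<Rightarrow> complex \<Rightarrow> bool" where
  "rat_value f e v \<longleftrightarrow>
     (\<exists>p q. poly q e \<noteq> 0 \<and> f = Fraction_Field.Fract p q \<and> v = poly p e / poly q e)"

text \<open>The coordinates range over a set \<open>U\<close>. A function on \<open>U\<close> is represented by its extension
  by \<open>0\<close>, so that functions on \<open>U\<close> are equal iff their representatives are.\<close>

definition const_on :: "(complex^'r) set \<Rightarrow> complex \<Rightarrow> complex^'r \<Rightarrow> complex" where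
  "const_on U c = (\<lambda>x. if x \<in> U then c else 0)"

definition pd :: "(complex^'r) set \<Rightarrow> 'r \<Rightarrow> (complex^'r \<Rightarrow> complex) \<Rightarrow> complex^'r \<Rightarrow> complex" where
  "pd U k f = (\<lambda>x. if x \<in> U then deriv (\<lambda>z. f (x + axis k z)) 0 else 0)"

text \<open>\<open>has_differential f w x\<close>: the differential of \<open>f\<close> at \<open>x\<close> exists, is complex linear, and
  equals \<open>\<Sum>k. w $ k dx\<^sub>k\<close>.\<close>

definition has_differential :: "(complex^'r \<Rightarrow> complex) \<Rightarrow> complex^'r \<Rightarrow> complex^'r \<Rightarrow> bool" where
  "has_differential f w x \<longleftrightarrow> (f has_derivative (\<lambda>h. \<Sum>k\<in>UNIV. w $ k * h $ k)) (at x)"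

definition function_algebra ::
    "complex set \<Rightarrow> (complex^'r) set \<Rightarrow> (complex^'r \<Rightarrow> complex) set \<Rightarrow> bool" where
  "function_algebra K U \<A> \<longleftrightarrow>
     (\<forall>f\<in>\<A>. (\<forall>x. x \<notin> U \<longrightarrow> f x = 0) \<and> (\<forall>x\<in>U. \<exists>w. has_differential f w x)) \<and>
     (\<forall>f\<in>\<A>. \<forall>g\<in>\<A>. (\<lambda>x. f x + g x) \<in> \<A> \<and> (\<lambda>x. f x * g x) \<in> \<A>) \<and>
     (\<forall>c\<in>K. \<forall>f\<in>\<A>. (\<lambda>x. c * f x) \<in> \<A>) \<and>
     (\<forall>f\<in>\<A>. \<forall>k. pd U k f \<in> \<A>) \<and>
     {f \<in> \<A>. \<forall>k. pd U k f = (\<lambda>x. 0)} = const_on U ` K"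

inductive_set polynomial_funs :: "(complex^'r \<Rightarrow> complex) set" where
  const: "(\<lambda>x. c) \<in> polynomial_funs"
| coord: "(\<lambda>x. x $ k) \<in> polynomial_funs"
| add: "f \<in> polynomial_funs \<Longrightarrow> g \<in> polynomial_funs \<Longrightarrow> (\<lambda>x. f x + g x) \<in> polynomial_funs"
| mult: "f \<in> polynomial_funs \<Longrightarrow> g \<in> polynomial_funs \<Longrightarrow> (\<lambda>x. f x * g x) \<in> polynomial_funs"

definition rational_on :: "(complex^'r) set \<Rightarrow> (complex^'r \<Rightarrow> complex) \<Rightarrow> bool" where
  "rational_on U f \<longleftrightarrow>
     (\<exists>p\<in>polynomial_funs. \<exists>q\<in>polynomial_funs. (\<exists>x. q x \<noteq> 0) \<and> (\<forall>x\<in>U. f x * q x = p x))"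

text \<open>The algebra \<open>\<A> \<otimes> K(\<epsilon>)\<close> over \<open>K\<close>. The tensor \<open>\<Sum>i. a\<^sub>i \<otimes> f\<^sub>i\<close> is identified with the map
  \<open>x \<mapsto> \<Sum>i. a\<^sub>i(x) f\<^sub>i\<close> from \<open>U\<close> to the rational functions over the complex numbers. No information
  is lost: elements of \<open>K(\<epsilon>)\<close> that are linearly independent over \<open>K\<close> remain so over the complex
  numbers, hence this map is injective on the tensor product.\<close>

definition alg_eps ::
    "complex set \<Rightarrow> (complex^'r \<Rightarrow> complex) set \<Rightarrow> (complex^'r \<Rightarrow> complex poly fract) set" where
  "alg_eps K \<A> = {\<lambda>x. \<Sum>i<m. rat_const (a i x) * f i | (m::nat) a f.
                     \<forall>i<m. a i \<in> \<A> \<and> f i \<in> ratfuns K}"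

definition in_GL_eps ::
    "complex set \<Rightarrow> (complex^'r) set \<Rightarrow> (complex^'r \<Rightarrow> complex) set \<Rightarrow>
     (complex^'r \<Rightarrow> (complex poly fract, 'n::finite) sq_matrix) \<Rightarrow> bool" where
  "in_GL_eps K U \<A> D \<longleftrightarrow>
     (\<forall>i j. (\<lambda>x. D x $ i $ j) \<in> alg_eps K \<A>) \<and>
     (\<exists>D'. (\<forall>i j. (\<lambda>x. D' x $ i $ j) \<in> alg_eps K \<A>) \<and>
           (\<forall>x\<in>U. D x ** D' x = mat 1 \<and> D' x ** D x = mat 1))"

text \<open>The one-form \<open>\<Sum>k. f\<^sub>k dx\<^sub>k\<close> is given by its coefficient vector \<open>x \<mapsto> (f\<^sub>k(x))\<^sub>k\<close>, and a two-form
  \<open>\<Sum>k<l. h\<^sub>k\<^sub>l dx\<^sub>k \<and> dx\<^sub>l\<close> by its antisymmetric coefficients \<open>h\<^sub>k\<^sub>l = - h\<^sub>l\<^sub>k\<close>, indexed by pairs.\<close>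

type_synonym 'r one_form = "complex^'r \<Rightarrow> complex^'r"
type_synonym 'r two_form = "complex^'r \<Rightarrow> complex^('r \<times> 'r)"

definition wedge :: "('r::finite) one_form \<Rightarrow> ('r::finite) one_form \<Rightarrow> ('r::finite) two_form" where
  "wedge \<alpha> \<beta> = (\<lambda>x. \<chi> kl. \<alpha> x $ fst kl * \<beta> x $ snd kl - \<alpha> x $ snd kl * \<beta> x $ fst kl)"

definition closed_one_forms ::
    "(complex^'r) set \<Rightarrow> (complex^'r \<Rightarrow> complex) set \<Rightarrow> ('r::finite) one_form set" where
  "closed_one_forms U \<A> = {\<omega>. (\<forall>k. (\<lambda>x. \<omega> x $ k) \<in> \<A>) \<and>
     (\<forall>k l. pd U k (\<lambda>x. \<omega> x $ l) = pd U l (\<lambda>x. \<omega> x $ k))}"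

definition closed_two_forms ::
    "(complex^'r) set \<Rightarrow> (complex^'r \<Rightarrow> complex) set \<Rightarrow> ('r::finite) two_form set" where
  "closed_two_forms U \<A> = {\<eta>. (\<forall>kl. (\<lambda>x. \<eta> x $ kl) \<in> \<A>) \<and>
     (\<forall>k l x. \<eta> x $ (k, l) = - \<eta> x $ (l, k)) \<and>
     (\<forall>k l m x. pd U k (\<lambda>y. \<eta> y $ (l, m)) x + pd U l (\<lambda>y. \<eta> y $ (m, k)) x
              + pd U m (\<lambda>y. \<eta> y $ (k, l)) x = 0)}"

definition form_span ::
    "complex set \<Rightarrow> ('i \<Rightarrow> complex^'r \<Rightarrow> complex^'m) \<Rightarrow> 'i set \<Rightarrow> (complex^'r \<Rightarrow> complex^'m) set" where
  "form_span K F I = {\<lambda>x. \<Sum>i\<in>I. c i *s F i x | c. \<forall>i\<in>I. c i \<in> K}"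

definition form_indep ::
    "complex set \<Rightarrow> ('i \<Rightarrow> complex^'r \<Rightarrow> complex^'m) \<Rightarrow> 'i set \<Rightarrow> bool" where
  "form_indep K F I \<longleftrightarrow>
     (\<forall>c. (\<forall>i\<in>I. c i \<in> K) \<and> (\<forall>x. (\<Sum>i\<in>I. c i *s F i x) = 0) \<longrightarrow> (\<forall>i\<in>I. c i = 0))"

definition entry_space :: "complex set \<Rightarrow> (('r::finite) one_form, 'n::finite) sq_matrix \<Rightarrow> ('r::finite) one_form set" where
  "entry_space K A = form_span K (\<lambda>(i, j). A $ i $ j) UNIV"

definition wedge_square_zero :: "(('r::finite) one_form, 'n::finite) sq_matrix \<Rightarrow> bool" where
  "wedge_square_zero A \<longleftrightarrow>
     (\<forall>i j x. (\<Sum>l\<in>UNIV. wedge (A $ i $ l) (A $ l $ j) x) = 0)"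

text \<open>Elements of the tensor product of the complex numbers with \<open>\<A>\<close> over \<open>K\<close> are represented by
  formal sums of pairs \<open>(c, a)\<close>, read as \<open>c \<otimes> a\<close>. Two formal sums represent the same tensor iff
  every \<open>K\<close>-bilinear map takes the same value on them; since \<open>K\<close> is a field, bilinear maps
  into one nonzero vector space suffice. (Evaluating \<open>c \<otimes> a\<close> as the function \<open>x \<mapsto> c a(x)\<close> instead
  could identify different tensors.)\<close>

type_synonym 'r tensor = "(complex \<times> (complex^'r \<Rightarrow> complex)) list"

definition bilinear_over ::
    "complex set \<Rightarrow> (complex^'r \<Rightarrow> complex) set \<Rightarrow>
     (complex \<Rightarrow> (complex^'r \<Rightarrow> complex) \<Rightarrow> complex) \<Rightarrow> bool" where
  "bilinear_over K \<A> \<beta> \<longleftrightarrow>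
     (\<forall>c c'. \<forall>a\<in>\<A>. \<beta> (c + c') a = \<beta> c a + \<beta> c' a) \<and>
     (\<forall>c. \<forall>a\<in>\<A>. \<forall>a'\<in>\<A>. \<beta> c (\<lambda>x. a x + a' x) = \<beta> c a + \<beta> c a') \<and>
     (\<forall>\<kappa>\<in>K. \<forall>c. \<forall>a\<in>\<A>. \<beta> (\<kappa> * c) a = \<kappa> * \<beta> c a \<and> \<beta> c (\<lambda>x. \<kappa> * a x) = \<kappa> * \<beta> c a)"

definition tensors :: "(complex^'r \<Rightarrow> complex) set \<Rightarrow> ('r::finite) tensor set" where
  "tensors \<A> = {s. snd ` set s \<subseteq> \<A>}"

definition tensor_eq ::
    "complex set \<Rightarrow> (complex^'r \<Rightarrow> complex) set \<Rightarrow> ('r::finite) tensor \<Rightarrow> ('r::finite) tensor \<Rightarrow> bool" where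
  "tensor_eq K \<A> s t \<longleftrightarrow>
     (\<forall>\<beta>. bilinear_over K \<A> \<beta> \<longrightarrow>
        sum_list (map (\<lambda>(c, a). \<beta> c a) s) = sum_list (map (\<lambda>(c, a). \<beta> c a) t))"

definition tensor_mult :: "('r::finite) tensor \<Rightarrow> ('r::finite) tensor \<Rightarrow> ('r::finite) tensor" where
  "tensor_mult s t =
     concat (map (\<lambda>(c, a). map (\<lambda>(c', a'). (c * c', (\<lambda>x. a x * a' x))) t) s)"

definition tensor_pd :: "(complex^'r) set \<Rightarrow> 'r \<Rightarrow> ('r::finite) tensor \<Rightarrow> ('r::finite) tensor" where
  "tensor_pd U k s = map (\<lambda>(c, a). (c, pd U k a)) s"

definition tensor_regular ::
    "complex set \<Rightarrow> (complex^'r \<Rightarrow> complex) set \<Rightarrow> ('r::finite) tensor \<Rightarrow> bool" where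
  "tensor_regular K \<A> v \<longleftrightarrow>
     (\<forall>w\<in>tensors \<A>. tensor_eq K \<A> (tensor_mult v w) [] \<longrightarrow> tensor_eq K \<A> w [])"

text \<open>\<open>exact_one_forms K U \<A>\<close> are the one-forms over \<open>\<A>\<close> that are of the form \<open>d(u/v)\<close> for some
  fraction \<open>u/v\<close>, i.e. \<open>v\<^sup>2 \<omega> + u dv = v du\<close>. Denominators are non-zero-divisors, which
  in an integral domain means \<open>v \<noteq> 0\<close>.\<close>

definition exact_one_forms ::
    "complex set \<Rightarrow> (complex^'r) set \<Rightarrow> (complex^'r \<Rightarrow> complex) set \<Rightarrow> ('r::finite) one_form set" where
  "exact_one_forms K U \<A> = {\<omega>. (\<forall>k. (\<lambda>x. \<omega> x $ k) \<in> \<A>) \<and>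
     (\<exists>u\<in>tensors \<A>. \<exists>v\<in>tensors \<A>. tensor_regular K \<A> v \<and>
        (\<forall>k. tensor_eq K \<A>
           (tensor_mult (tensor_mult v v) [(1, \<lambda>x. \<omega> x $ k)] @ tensor_mult u (tensor_pd U k v))
           (tensor_mult v (tensor_pd U k u))))}"

definition C_form ::
    "complex set \<Rightarrow> (complex^'r) set \<Rightarrow> (complex^'r \<Rightarrow> complex) set \<Rightarrow> (('r::finite) one_form, 'n::finite) sq_matrix \<Rightarrow> bool" where
  "C_form K U \<A> A \<longleftrightarrow> entry_space K A \<inter> exact_one_forms K U \<A> = {\<lambda>x. 0}"

text \<open>The free Lie algebra over \<open>K\<close> on \<open>t\<^sub>0, \<dots>, t\<^sub>p\<^sub>-\<^sub>1\<close> consists of the expressions in \<open>lie_exprs K p\<close>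
  modulo \<open>lie_eq K p\<close>, the least congruence that enforces the axioms of a Lie algebra over \<open>K\<close>.\<close>

datatype lie_expr =
    Gen nat
  | LZero
  | LAdd lie_expr lie_expr
  | LScale complex lie_expr
  | LBracket lie_expr lie_expr

inductive_set lie_exprs :: "complex set \<Rightarrow> nat \<Rightarrow> lie_expr set" for K p where
  "i < p \<Longrightarrow> Gen i \<in> lie_exprs K p"
| "LZero \<in> lie_exprs K p"
| "s \<in> lie_exprs K p \<Longrightarrow> t \<in> lie_exprs K p \<Longrightarrow> LAdd s t \<in> lie_exprs K p"
| "c \<in> K \<Longrightarrow> s \<in> lie_exprs K p \<Longrightarrow> LScale c s \<in> lie_exprs K p"
| "s \<in> lie_exprs K p \<Longrightarrow> t \<in> lie_exprs K p \<Longrightarrow> LBracket s t \<in> lie_exprs K p"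

abbreviation LMinus :: "lie_expr \<Rightarrow> lie_expr \<Rightarrow> lie_expr" where
  "LMinus s t \<equiv> LAdd s (LScale (-1) t)"

inductive lie_eq :: "complex set \<Rightarrow> nat \<Rightarrow> lie_expr \<Rightarrow> lie_expr \<Rightarrow> bool" for K p where
  refl: "s \<in> lie_exprs K p \<Longrightarrow> lie_eq K p s s"
| sym: "lie_eq K p s t \<Longrightarrow> lie_eq K p t s"
| trans: "lie_eq K p s t \<Longrightarrow> lie_eq K p t u \<Longrightarrow> lie_eq K p s u"
| cong_add: "lie_eq K p s s' \<Longrightarrow> lie_eq K p t t' \<Longrightarrow> lie_eq K p (LAdd s t) (LAdd s' t')"
| cong_scale: "c \<in> K \<Longrightarrow> lie_eq K p s s' \<Longrightarrow> lie_eq K p (LScale c s) (LScale c s')"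
| cong_bracket:
    "lie_eq K p s s' \<Longrightarrow> lie_eq K p t t' \<Longrightarrow> lie_eq K p (LBracket s t) (LBracket s' t')"
| add_assoc: "{s, t, u} \<subseteq> lie_exprs K p \<Longrightarrow>
    lie_eq K p (LAdd (LAdd s t) u) (LAdd s (LAdd t u))"
| add_commute: "{s, t} \<subseteq> lie_exprs K p \<Longrightarrow> lie_eq K p (LAdd s t) (LAdd t s)"
| add_zero: "s \<in> lie_exprs K p \<Longrightarrow> lie_eq K p (LAdd s LZero) s"
| add_minus: "s \<in> lie_exprs K p \<Longrightarrow> lie_eq K p (LMinus s s) LZero"
| scale_add: "c \<in> K \<Longrightarrow> {s, t} \<subseteq> lie_exprs K p \<Longrightarrow>
    lie_eq K p (LScale c (LAdd s t)) (LAdd (LScale c s) (LScale c t))"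
| add_scale: "{c, c'} \<subseteq> K \<Longrightarrow> s \<in> lie_exprs K p \<Longrightarrow>
    lie_eq K p (LScale (c + c') s) (LAdd (LScale c s) (LScale c' s))"
| scale_scale: "{c, c'} \<subseteq> K \<Longrightarrow> s \<in> lie_exprs K p \<Longrightarrow>
    lie_eq K p (LScale (c * c') s) (LScale c (LScale c' s))"
| scale_one: "s \<in> lie_exprs K p \<Longrightarrow> lie_eq K p (LScale 1 s) s"
| bracket_add_left: "{s, t, u} \<subseteq> lie_exprs K p \<Longrightarrow>
    lie_eq K p (LBracket (LAdd s t) u) (LAdd (LBracket s u) (LBracket t u))"
| bracket_add_right: "{s, t, u} \<subseteq> lie_exprs K p \<Longrightarrow>
    lie_eq K p (LBracket s (LAdd t u)) (LAdd (LBracket s t) (LBracket s u))"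
| bracket_scale_left: "c \<in> K \<Longrightarrow> {s, t} \<subseteq> lie_exprs K p \<Longrightarrow>
    lie_eq K p (LBracket (LScale c s) t) (LScale c (LBracket s t))"
| bracket_scale_right: "c \<in> K \<Longrightarrow> {s, t} \<subseteq> lie_exprs K p \<Longrightarrow>
    lie_eq K p (LBracket s (LScale c t)) (LScale c (LBracket s t))"
| bracket_self: "s \<in> lie_exprs K p \<Longrightarrow> lie_eq K p (LBracket s s) LZero"
| jacobi: "{s, t, u} \<subseteq> lie_exprs K p \<Longrightarrow>
    lie_eq K p (LAdd (LBracket s (LBracket t u))
                 (LAdd (LBracket t (LBracket u s)) (LBracket u (LBracket s t)))) LZero"

text \<open>Expressions whose class in the free Lie algebra lies in the Lie ideal generated by \<open>R\<close>.\<close>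

inductive_set lie_ideal :: "complex set \<Rightarrow> nat \<Rightarrow> lie_expr set \<Rightarrow> lie_expr set" for K p R where
  gen: "r \<in> R \<Longrightarrow> r \<in> lie_ideal K p R"
| zero: "LZero \<in> lie_ideal K p R"
| add: "s \<in> lie_ideal K p R \<Longrightarrow> t \<in> lie_ideal K p R \<Longrightarrow> LAdd s t \<in> lie_ideal K p R"
| scale: "c \<in> K \<Longrightarrow> s \<in> lie_ideal K p R \<Longrightarrow> LScale c s \<in> lie_ideal K p R"
| bracket: "s \<in> lie_exprs K p \<Longrightarrow> t \<in> lie_ideal K p R \<Longrightarrow> LBracket s t \<in> lie_ideal K p R"
| eq: "s \<in> lie_ideal K p R \<Longrightarrow> lie_eq K p s t \<Longrightarrow> t \<in> lie_ideal K p R"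

text \<open>The quotient of the free Lie algebra by that ideal. Its elements are the classes
  \<open>lie_class K p R s\<close>, and the operations are induced by those on expressions.\<close>

definition lie_class :: "complex set \<Rightarrow> nat \<Rightarrow> lie_expr set \<Rightarrow> lie_expr \<Rightarrow> lie_expr set" where
  "lie_class K p R s = {t \<in> lie_exprs K p. LMinus s t \<in> lie_ideal K p R}"

definition lie_quotient :: "complex set \<Rightarrow> nat \<Rightarrow> lie_expr set \<Rightarrow> lie_expr set set" where
  "lie_quotient K p R = lie_class K p R ` lie_exprs K p"

text \<open>The relators \<open>\<Sum>i j. a\<^sub>i\<^sub>j\<^sub>k [t\<^sub>i, t\<^sub>j]\<close> for \<open>k < q\<close>.\<close>

definition quadratic_relators :: "nat \<Rightarrow> nat \<Rightarrow> (nat \<Rightarrow> nat \<Rightarrow> nat \<Rightarrow> complex) \<Rightarrow> lie_expr set" where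
  "quadratic_relators p q a =
     (\<lambda>k. foldr LAdd
        (concat (map (\<lambda>i. map (\<lambda>j. LScale (a i j k) (LBracket (Gen i) (Gen j))) [0..<p]) [0..<p]))
        LZero) ` {..<q}"

definition lie_representation ::
    "complex set \<Rightarrow> nat \<Rightarrow> lie_expr set \<Rightarrow> (lie_expr set \<Rightarrow> (complex, 'n::finite) sq_matrix) \<Rightarrow> bool" where
  "lie_representation K p R \<rho> \<longleftrightarrow>
     (\<forall>s\<in>lie_exprs K p. \<forall>t\<in>lie_exprs K p.
        \<rho> (lie_class K p R (LAdd s t)) = \<rho> (lie_class K p R s) + \<rho> (lie_class K p R t) \<and>
        \<rho> (lie_class K p R (LBracket s t)) =
          \<rho> (lie_class K p R s) ** \<rho> (lie_class K p R t)
          - \<rho> (lie_class K p R t) ** \<rho> (lie_class K p R s)) \<and>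
     (\<forall>c\<in>K. \<forall>s\<in>lie_exprs K p.
        \<rho> (lie_class K p R (LScale c s)) = mat c ** \<rho> (lie_class K p R s))"

text \<open>In the following, \<open>L\<close> is the underlying set of the Lie algebra.\<close>

definition equivalent_reps ::
    "'l set \<Rightarrow> ('l \<Rightarrow> (complex, 'n::finite) sq_matrix) \<Rightarrow> ('l \<Rightarrow> (complex, 'n::finite) sq_matrix) \<Rightarrow> bool" where
  "equivalent_reps L \<rho>1 \<rho>2 \<longleftrightarrow>
     (\<exists>M. invertible M \<and> (\<forall>X\<in>L. \<rho>2 X = M ** \<rho>1 X ** matrix_inv M))"

definition dual_rep :: "('l \<Rightarrow> (complex, 'n::finite) sq_matrix) \<Rightarrow> 'l \<Rightarrow> (complex, 'n::finite) sq_matrix" where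
  "dual_rep \<rho> = (\<lambda>X. - transpose (\<rho> X))"

definition self_dual :: "'l set \<Rightarrow> ('l \<Rightarrow> (complex, 'n::finite) sq_matrix) \<Rightarrow> bool" where
  "self_dual L \<rho> \<longleftrightarrow> equivalent_reps L \<rho> (dual_rep \<rho>)"

text \<open>Block upper-triangular: the rows and columns are split at an index \<open>k\<close> that is not the first
  one, so that both diagonal blocks are nonempty, and the lower left block vanishes.\<close>

definition reducible ::
    "'l set \<Rightarrow> ('l \<Rightarrow> (complex, 'n::{finite,linorder}) sq_matrix) \<Rightarrow> bool" where
  "reducible L \<rho> \<longleftrightarrow>
     (\<exists>(M :: (complex, 'n) sq_matrix) k. invertible M \<and> (\<exists>j. j < k) \<and>
        (\<forall>X\<in>L. \<forall>i j. k \<le> i \<and> j < k \<longrightarrow> (M ** \<rho> X ** matrix_inv M) $ i $ j = 0))"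

definition irreducible_rep ::
    "'l set \<Rightarrow> ('l \<Rightarrow> (complex, 'n::{finite,linorder}) sq_matrix) \<Rightarrow> bool" where
  "irreducible_rep L \<rho> \<longleftrightarrow> \<not> reducible L \<rho>"

end

theory Submission
  imports Defs "HOL-Computational_Algebra.Fundamental_Theorem_Algebra"
begin

text \<open>Clearing denominators turns \<open>\<Delta>\<close> into a matrix \<open>R\<close> of polynomials in \<open>\<epsilon>\<close> with coefficients in
  the function algebra. The differential equation holds at infinitely many \<open>\<epsilon>\<close>, hence
  coefficientwise: \<open>dR\<^sub>k\<^sub>+\<^sub>1 = A R\<^sub>k - R\<^sub>k A\<^sup>T\<close> and \<open>dR\<^sub>0 = 0\<close>. If \<open>R\<^sub>k\<close> is constant, the entries of
  \<open>dR\<^sub>k\<^sub>+\<^sub>1\<close> are exact forms in the span of the entries of \<open>A\<close>, so they vanish by the C-form condition.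
  Inductively all \<open>R\<^sub>k\<close> are constant and satisfy \<open>A\<^sub>i R\<^sub>k = R\<^sub>k A\<^sub>i\<^sup>T\<close>. Two solutions of this linear
  system, one of them invertible, differ by a matrix commuting with the irreducible representation,
  which is a scalar by Schur's lemma. Hence the \<open>R\<^sub>k\<close> are all proportional to one \<open>\<Delta>\<^sub>0\<close>; since
  \<open>\<Delta>\<^sub>0\<^sup>T\<close> is again a solution, it is \<open>c \<Delta>\<^sub>0\<close> with \<open>c\<^sup>2 = 1\<close>.\<close>

subsection \<open>Schur's lemma\<close>

lemma mat_mult_left: "(mat c ** X) $ i $ j = c * X $ i $ j"
  for X :: "('a::comm_semiring_1, 'n::finite) sq_matrix"
  by (simp add: mat_def matrix_matrix_mult_def if_distrib if_distribR cong: if_cong)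

lemma mat_mult_vector: "mat c *v v = c *s v" for v :: "'a::comm_semiring_1 ^ 'n::finite"
  by (simp add: vec_eq_iff mat_def matrix_vector_mult_def if_distrib if_distribR cong: if_cong)

lemma matrix_mult_mat: "X ** mat c = mat c ** X" for X :: "('a::comm_ring_1, 'n::finite) sq_matrix"
  by (simp add: vec_eq_iff mat_def matrix_matrix_mult_def if_distrib if_distribR mult.commute cong: if_cong)

lemma matrix_inv_cancel:
  fixes M :: "('a::field, 'n::finite) sq_matrix"
  assumes "invertible M"
  shows "matrix_inv M ** M = mat 1" "M ** matrix_inv M = mat 1"
  using someI_ex[OF assms[unfolded invertible_def]] unfolding matrix_inv_def by auto

lemma invertible_matrix_inv:
  fixes M :: "('a::field, 'n::finite) sq_matrix"
  assumes "invertible M"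
  shows "invertible (matrix_inv M)"
  using matrix_inv_cancel[OF assms] unfolding invertible_def by auto

lemma matrix_inv_unique:
  fixes M :: "('a::field, 'n::finite) sq_matrix"
  assumes "M ** B = mat 1"
  shows "matrix_inv M = B"
proof -
  have "invertible M"
    using assms invertible_right_inverse by blast
  then have "matrix_inv M ** (M ** B) = B"
    by (simp add: matrix_mul_assoc matrix_inv_cancel)
  then show ?thesis
    by (simp add: assms)
qed

lemma invertible_transpose:
  fixes M :: "('a::field, 'n::finite) sq_matrix"
  assumes "invertible M"
  shows "invertible (transpose M)"
  using assms by (simp add: invertible_right_inverse right_invertible_transpose)
    (simp flip: invertible_left_inverse invertible_right_inverse)

text \<open>An eigenvalue is a root of the characteristic polynomial \<open>cp\<close>. The
  fundamental theorem of algebra supplies a root once \<open>cp\<close> is known not to be a nonzero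
  constant; comparison with the reversed polynomial shows this without computing a leading
  term.\<close>

lemma eigenvalue_exists:
  fixes X :: "(complex, 'n::finite) sq_matrix"
  obtains l v where "v \<noteq> 0" "X *v v = l *s v"
proof -
  define cp where "cp = det (\<chi> i j. [:- X $ i $ j, if i = j then 1 else 0:] :: (complex poly, 'n) sq_matrix)"
  have cp: "poly cp l = det (mat l - X)" for l
    unfolding cp_def det_def
    by (auto simp: poly_sum poly_prod mat_def algebra_simps intro!: sum.cong prod.cong)
  \<comment> \<open>The reversed characteristic polynomial: m^n cp(1/m) away from 0, and 1 at
    0.\<close>
  define rp where "rp = det (\<chi> i j. [:if i = j then 1 else 0, - X $ i $ j:] :: (complex poly, 'n) sq_matrix)"
  have rp: "poly rp l = det (mat 1 - (\<chi> i j. l * X $ i $ j))" for l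
    unfolding rp_def det_def
    by (auto simp: poly_sum poly_prod mat_def algebra_simps intro!: sum.cong prod.cong)
  have rel: "poly rp m = m ^ CARD('n) * poly cp (1 / m)" if "m \<noteq> 0" for m
  proof -
    have "mat 1 - (\<chi> i j. m * X $ i $ j) = (\<chi> i. m *s (mat (1 / m) - X) $ i)"
      using that by (simp add: vec_eq_iff mat_def algebra_simps)
    then have "poly rp m = det (\<chi> i. m *s (mat (1 / m) - X) $ i)"
      by (simp only: rp)
    also have "\<dots> = m ^ CARD('n) * det (mat (1 / m) - X)"
      using det_rows_mul[of "\<lambda>_. m" "\<lambda>i. (mat (1 / m) - X) $ i"]
      by (simp only: prod_constant vec_lambda_eta)
    finally show ?thesis
      by (simp only: cp)
  qed
  \<comment> \<open>If \<open>cp\<close> were a constant c, then \<open>rp\<close> would agree with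
    c m^n off 0, hence everywhere, and so vanish at 0.\<close>
  have "\<not> (\<exists>c l. c \<noteq> 0 \<and> l = 0 \<and> cp = pCons c l)"
  proof
    assume "\<exists>c l. c \<noteq> 0 \<and> l = 0 \<and> cp = pCons c l"
    then obtain c where c: "poly cp l = c" for l
      by auto
    have "{m. poly (rp - monom c (CARD('n))) m = 0} \<supseteq> UNIV - {0}"
      using rel c by (auto simp: poly_monom)
    moreover have "infinite (UNIV - {0 :: complex})"
      by (simp add: infinite_UNIV_char_0)
    ultimately have "rp - monom c (CARD('n)) = 0"
      using poly_roots_finite infinite_super by blast
    then have "poly rp 0 = poly (monom c (CARD('n))) 0"
      by simp
    moreover have "poly rp 0 = 1"
      using rp[of 0] by (simp add: zero_vec_def[symmetric] det_I)
    ultimately show False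
      by (simp add: poly_monom zero_power)
  qed
  from fundamental_theorem_of_algebra_alt[OF this] obtain l where "det (mat l - X) = 0"
    using cp by auto
  then have "\<not> (\<exists>B. B ** (mat l - X) = mat 1)"
    using invertible_left_inverse invertible_det_nz by blast
  then obtain v where "(mat l - X) *v v = 0" "v \<noteq> 0"
    unfolding matrix_left_invertible_ker by blast
  then show thesis
    by (intro that[of v l]) (simp_all add: matrix_vector_mult_diff_rdistrib mat_mult_vector)
qed

text \<open>Block shapes are cut at an element of the ordered index type, so a block size must be
  turned into an index with that many predecessors. In the induction the inserted maximum serves the
  size \<open>card A\<close>.\<close>

lemma initial_segment_card:
  fixes A :: "'a::linorder set"
  assumes "finite A" "d < card A"
  shows "\<exists>k\<in>A. card {j \<in> A. j < k} = d"
  using assms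
proof (induction A rule: finite_linorder_max_induct)
  case (insert b A)
  have "b \<notin> A"
    using insert by blast
  show ?case
  proof (cases "d = card A")
    case True
    have "{j \<in> insert b A. j < b} = A"
      using insert by auto
    then show ?thesis using True by auto
  next
    case False
    then obtain k where k: "k \<in> A" "card {j \<in> A. j < k} = d"
      using insert \<open>b \<notin> A\<close> by auto
    moreover have "{j \<in> insert b A. j < k} = {j \<in> A. j < k}"
      using insert k by auto
    ultimately show ?thesis by (metis insertI2)
  qed
qed auto

text \<open>Change to a basis of the whole space that lists a basis of \<open>W\<close> first:
  invariance makes the lower left block vanish, and \<open>W\<close> being nonzero and proper makes
  both diagonal blocks nonempty.\<close>

lemma reducible_of_invariant_subspace:
  fixes \<rho> :: "'l \<Rightarrow> (complex, 'n::{finite,linorder}) sq_matrix"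
  assumes W: "vec.subspace W" "W \<noteq> {0}" "W \<noteq> UNIV"
    and inv: "\<And>Y v. Y \<in> L \<Longrightarrow> v \<in> W \<Longrightarrow> \<rho> Y *v v \<in> W"
  shows "reducible L \<rho>"
proof -
  obtain B where B: "B \<subseteq> W" "vec.independent B" "W \<subseteq> vec.span B" "card B = vec.dim W"
    using vec.basis_exists by blast
  obtain B' where B': "B \<subseteq> B'" "vec.independent B'" "UNIV \<subseteq> vec.span B'"
    by (rule vec.maximal_independent_subset_extend[OF subset_UNIV B(2)]) blast
  have fin: "finite B'" "finite B"
    using B(2) B'(2) vec.finiteI_independent by auto
  have card': "card B' = CARD('n)"
    using vec.basis_card_eq_dim[OF subset_UNIV B'(3,2)] vec_dim_card by metis
  have "B \<noteq> B'"
    using B W(1,3) B' by (metis subset_antisym top_greatest vec.span_minimal)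
  then have less: "card B < CARD('n)"
    using B' fin card' by (metis psubsetI psubset_card_mono)
  have "B \<noteq> {}"
    using B(3) W(1,2) vec.subspace_0 by fastforce
  then have pos: "card B > 0"
    using fin by (simp add: card_gt_0_iff)
  obtain k :: 'n where k: "card {j. j < k} = card B"
    using initial_segment_card[of "UNIV :: 'n set" "card B"] less by auto
  have "card (UNIV - {j. j < k}) = card (B' - B)"
    using k card' B'(1) fin by (simp add: card_Diff_subset)
  then obtain g1 g2 where g1: "bij_betw g1 {j. j < k} B" and g2: "bij_betw g2 (UNIV - {j. j < k}) (B' - B)"
    using finite_same_card_bij[OF _ _ k] finite_same_card_bij fin by (metis finite finite_Diff)
  \<comment> \<open>\<open>g\<close> lists the columns of the base change: the basis
    \<open>B\<close> of \<open>W\<close> at the indices below \<open>k\<close>, the added vectors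
    elsewhere.\<close>
  define g where "g j = (if j < k then g1 j else g2 j)" for j
  have gB: "g ` {j. j < k} = B" 
    using g1 by (auto simp: g_def bij_betw_def)
  have gr: "range g = B'"
  proof -
    have "range g = g1 ` {j. j < k} \<union> g2 ` (UNIV - {j. j < k})"
      by (auto simp: g_def)
    then show ?thesis
      using g1 g2 B'(1) by (auto simp: bij_betw_def)
  qed
  define Q :: "(complex, 'n) sq_matrix" where "Q = (\<chi> i j. g j $ i)"
  have col: "column j Q = g j" for j
    by (simp add: column_def Q_def vec_eq_iff)
  have "columns Q = B'"
    using gr by (auto simp: columns_def col)
  then have Q: "invertible Q"
    using B'(3) by (auto simp: invertible_right_inverse matrix_right_invertible_span_columns)
  define M where "M = matrix_inv Q"
  have M: "invertible M" "matrix_inv M = Q" "M ** Q = mat 1"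
    using Q by (auto simp: M_def invertible_matrix_inv matrix_inv_cancel intro: matrix_inv_unique)
  have Mg: "M *v g j = axis j 1" for j
  proof -
    have "M *v g j = M *v (Q *v axis j 1)"
      by (simp add: vec_eq_iff matrix_vector_mult_def axis_def Q_def if_distrib cong: if_cong)
    then show ?thesis
      by (simp add: matrix_vector_mul_assoc M)
  qed
  \<comment> \<open>In the new coordinates all of \<open>W\<close> vanishes from index
    \<open>k\<close> on; as this condition cuts out a subspace, it suffices to check it on
    \<open>B\<close>.\<close>
  have "vec.subspace {w. \<forall>i\<ge>k. (M *v w) $ i = 0}"
    by (auto simp: vec.subspace_def matrix_vector_right_distrib matrix_vector_mult_scaleR vector_scalar_commute)
  moreover have "B \<subseteq> {w. \<forall>i\<ge>k. (M *v w) $ i = 0}"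
    by (auto simp: gB[symmetric] Mg axis_def)
  ultimately have WM: "W \<subseteq> {w. \<forall>i\<ge>k. (M *v w) $ i = 0}"
    using B(3) vec.span_minimal by blast
  have "(M ** \<rho> Y ** matrix_inv M) $ i $ j = 0" if "Y \<in> L" "k \<le> i" "j < k" for Y i j
  proof -
    have "g j \<in> W"
      using gB B(1) that by auto
    then have "(M *v (\<rho> Y *v g j)) $ i = 0"
      using WM inv that by blast
    moreover have "(M ** \<rho> Y ** Q) $ i $ j = (M *v (\<rho> Y *v column j Q)) $ i"
      by (simp only: matrix_mul_assoc[symmetric])
        (simp add: column_def matrix_matrix_mult_def matrix_vector_mult_def)
    ultimately show ?thesis
      by (simp add: M col)
  qed
  moreover have "\<exists>j. j < k"
    using pos k by (metis card.empty empty_Collect_eq less_irrefl)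
  ultimately show ?thesis
    unfolding reducible_def using M by blast
qed

text \<open>Matrices commuting with \<open>X\<close> preserve its eigenspaces. Some eigenspace is
  nonzero, and irreducibility forces it to be the whole space.\<close>

lemma schur:
  fixes \<rho> :: "'l \<Rightarrow> (complex, 'n::{finite,linorder}) sq_matrix"
  assumes irr: "irreducible_rep L \<rho>" and comm: "\<And>Y. Y \<in> L \<Longrightarrow> X ** \<rho> Y = \<rho> Y ** X"
  obtains c where "X = mat c"
proof -
  obtain l v where v: "v \<noteq> 0" "X *v v = l *s v"
    by (rule eigenvalue_exists)
  define W where "W = {w. X *v w = l *s w}"
  have "vec.subspace W"
    by (auto simp: W_def vec.subspace_def matrix_vector_right_distrib vector_scalar_commute
        vector_smult_assoc mult.commute vector_add_ldistrib)
  moreover have "W \<noteq> {0}"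
    using v by (auto simp: W_def)
  moreover have "\<rho> Y *v w \<in> W" if "Y \<in> L" "w \<in> W" for Y w
    using comm[OF that(1)] that(2)
    by (simp add: W_def matrix_vector_mul_assoc)
      (simp add: vector_scalar_commute flip: matrix_vector_mul_assoc)
  ultimately have "W = UNIV"
    using reducible_of_invariant_subspace[of W L \<rho>] irr unfolding irreducible_rep_def by blast
  then have "X = mat l"
    by (auto simp: W_def matrix_eq mat_mult_vector)
  then show thesis
    by (rule that)
qed

subsection \<open>Polynomials over a function algebra\<close>

lemma number_field_closed:
  assumes "number_field K"
  shows "0 \<in> K" "1 \<in> K" "a \<in> K \<Longrightarrow> - a \<in> K" "a \<in> K \<Longrightarrow> b \<in> K \<Longrightarrow> a + b \<in> K"
    "a \<in> K \<Longrightarrow> b \<in> K \<Longrightarrow> a - b \<in> K" "a \<in> K \<Longrightarrow> b \<in> K \<Longrightarrow> a * b \<in> K"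
    "a \<in> K \<Longrightarrow> b \<in> K \<Longrightarrow> a / b \<in> K"
proof -
  have one: "1 \<in> K" and diff: "a \<in> K \<Longrightarrow> b \<in> K \<Longrightarrow> a - b \<in> K"
    and mult: "a \<in> K \<Longrightarrow> b \<in> K \<Longrightarrow> a * b \<in> K" and inv: "a \<in> K \<Longrightarrow> inverse a \<in> K" for a b
    using assms by (auto simp: number_field_def)
  show "1 \<in> K" and "a \<in> K \<Longrightarrow> b \<in> K \<Longrightarrow> a - b \<in> K"
    and "a \<in> K \<Longrightarrow> b \<in> K \<Longrightarrow> a * b \<in> K"
    by (fact one diff mult)+
  show zero: "0 \<in> K"
    using diff[OF one one] by simp
  have minus: "a \<in> K \<Longrightarrow> - a \<in> K" for a
    using diff[OF zero, of a] by simp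
  then show "a \<in> K \<Longrightarrow> - a \<in> K" .
  show "a \<in> K \<Longrightarrow> b \<in> K \<Longrightarrow> a + b \<in> K"
    using diff[OF _ minus, of a b] by simp
  show "a \<in> K \<Longrightarrow> b \<in> K \<Longrightarrow> a / b \<in> K"
    using mult inv by (simp add: divide_inverse)
qed

lemma number_field_sum:
  assumes "number_field K" "\<And>i. i \<in> I \<Longrightarrow> f i \<in> K"
  shows "(\<Sum>i\<in>I. f i) \<in> K"
  using assms(2) by (induction I rule: infinite_finite_induct)
    (auto intro: number_field_closed[OF assms(1)])

lemma coeff_mult_closed:
  assumes "number_field K" "\<forall>i. coeff p i \<in> K" "\<forall>i. coeff q i \<in> K"
  shows "\<forall>i. coeff (p * q) i \<in> K"
  using assms by (auto simp: coeff_mult intro!: number_field_sum number_field_closed)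

lemma function_algebraD:
  assumes "function_algebra K U \<A>"
  shows "f \<in> \<A> \<Longrightarrow> x \<notin> U \<Longrightarrow> f x = 0"
    "f \<in> \<A> \<Longrightarrow> x \<in> U \<Longrightarrow> \<exists>w. has_differential f w x"
    "f \<in> \<A> \<Longrightarrow> g \<in> \<A> \<Longrightarrow> (\<lambda>x. f x + g x) \<in> \<A>"
    "c \<in> K \<Longrightarrow> f \<in> \<A> \<Longrightarrow> (\<lambda>x. c * f x) \<in> \<A>"
    "f \<in> \<A> \<Longrightarrow> pd U k f \<in> \<A>"
    "f \<in> \<A> \<Longrightarrow> (\<And>k. pd U k f = (\<lambda>x. 0)) \<Longrightarrow> f \<in> const_on U ` K"
    "c \<in> K \<Longrightarrow> const_on U c \<in> \<A>"
    "c \<in> K \<Longrightarrow> pd U k (const_on U c) = (\<lambda>x. 0)"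
  using assms unfolding function_algebra_def by (blast | metis (no_types, lifting) image_eqI mem_Collect_eq)+

lemma function_algebra_sum:
  assumes "number_field K" "function_algebra K U \<A>" "\<And>i. i \<in> I \<Longrightarrow> f i \<in> \<A>"
  shows "(\<lambda>x. \<Sum>i\<in>I. f i x) \<in> \<A>"
proof -
  have "(\<lambda>x. 0) \<in> \<A>"
    using function_algebraD(7)[OF assms(2), of 0] number_field_closed(1)[OF assms(1)]
    by (simp add: const_on_def)
  then show ?thesis
    using assms(3) by (induction I rule: infinite_finite_induct)
      (auto intro: function_algebraD[OF assms(2)])
qed

text \<open>Polynomials in \<open>\<epsilon>\<close> over the algebra; the common degree bound makes them finite sums of
  functions in the algebra times powers of \<open>\<epsilon>\<close>.\<close>

definition alg_polys :: "(complex^'r \<Rightarrow> complex) set \<Rightarrow> (complex^'r \<Rightarrow> complex poly) set" where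
  "alg_polys \<A> = {R. (\<exists>m. \<forall>x. \<forall>k\<ge>m. coeff (R x) k = 0) \<and> (\<forall>k. (\<lambda>x. coeff (R x) k) \<in> \<A>)}"

lemma alg_polys_add:
  assumes alg: "function_algebra K U \<A>" and "R \<in> alg_polys \<A>" "R' \<in> alg_polys \<A>"
  shows "(\<lambda>x. R x + R' x) \<in> alg_polys \<A>"
proof -
  obtain m m' where "\<forall>x. \<forall>k\<ge>m. coeff (R x) k = 0" "\<forall>x. \<forall>k\<ge>m'. coeff (R' x) k = 0"
    using assms by (auto simp: alg_polys_def)
  then have "\<exists>m. \<forall>x. \<forall>k\<ge>m. coeff (R x + R' x) k = 0"
    by (intro exI[of _ "max m m'"]) simp
  moreover have "(\<lambda>x. coeff (R x + R' x) k) \<in> \<A>" for k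
    using assms unfolding alg_polys_def by (auto intro!: function_algebraD[OF alg])
  ultimately show ?thesis
    unfolding alg_polys_def by blast
qed

lemma alg_polys_mult:
  assumes K: "number_field K" and alg: "function_algebra K U \<A>"
    and R: "R \<in> alg_polys \<A>" and q: "\<forall>i. coeff q i \<in> K"
  shows "(\<lambda>x. R x * q) \<in> alg_polys \<A>"
proof -
  obtain m where m: "\<forall>x. \<forall>k\<ge>m. coeff (R x) k = 0"
    using R by (auto simp: alg_polys_def)
  have "coeff (R x * q) k = 0" if "k \<ge> m + degree q" for x k
    unfolding coeff_mult
  proof (intro sum.neutral ballI)
    \<comment> \<open>Either \<open>i\<close> reaches the bound \<open>m\<close>, or
      \<open>k - i\<close> exceeds the degree of \<open>q\<close>.\<close>
    fix i assume "i \<in> {..k}"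
    then show "coeff (R x) i * coeff q (k - i) = 0"
      using that m by (cases "i < m") (auto simp: coeff_eq_0 dest: spec)
  qed
  moreover have "(\<lambda>x. coeff (R x * q) k) \<in> \<A>" for k
    unfolding coeff_mult
  proof (rule function_algebra_sum[OF K alg])
    fix i assume "i \<in> {..k}"
    have "(\<lambda>x. coeff q (k - i) * coeff (R x) i) \<in> \<A>"
      using R q by (intro function_algebraD[OF alg]) (auto simp: alg_polys_def)
    then show "(\<lambda>x. coeff (R x) i * coeff q (k - i)) \<in> \<A>"
      by (simp add: mult.commute)
  qed
  ultimately show ?thesis
    unfolding alg_polys_def by blast
qed

text \<open>The denominator \<open>q\<close> is the same for all points \<open>x\<close>: only then
  is each \<epsilon>-coefficient of the cleared function again an element of the algebra, which can
  be differentiated on its own.\<close>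

definition clears :: "complex set \<Rightarrow> (complex^'r \<Rightarrow> complex) set \<Rightarrow>
    complex poly \<Rightarrow> (complex^'r \<Rightarrow> complex poly fract) \<Rightarrow> bool" where
  "clears K \<A> q h \<longleftrightarrow> q \<noteq> 0 \<and> (\<forall>i. coeff q i \<in> K) \<and>
     (\<exists>R\<in>alg_polys \<A>. \<forall>x. h x * Fraction_Field.Fract q 1 = Fraction_Field.Fract (R x) 1)"

lemma clears_mult:
  assumes K: "number_field K" and alg: "function_algebra K U \<A>"
    and "clears K \<A> q h" "q' \<noteq> 0" "\<forall>i. coeff q' i \<in> K"
  shows "clears K \<A> (q * q') h"
proof -
  obtain R where R: "R \<in> alg_polys \<A>"
    "\<And>x. h x * Fraction_Field.Fract q 1 = Fraction_Field.Fract (R x) 1"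
    using assms by (auto simp: clears_def)
  have "h x * Fraction_Field.Fract (q * q') 1 = Fraction_Field.Fract (R x * q') 1" for x
  proof -
    have "h x * Fraction_Field.Fract (q * q') 1
        = h x * Fraction_Field.Fract q 1 * Fraction_Field.Fract q' 1"
      by (simp add: mult.assoc)
    then show ?thesis
      by (simp add: R)
  qed
  then show ?thesis
    using assms coeff_mult_closed[OF K] alg_polys_mult[OF K alg R(1) assms(5)]
    unfolding clears_def by (metis (no_types, lifting) mult_eq_0_iff)
qed

lemma clears_add:
  assumes alg: "function_algebra K U \<A>" and "clears K \<A> q h" "clears K \<A> q h'"
  shows "clears K \<A> q (\<lambda>x. h x + h' x)"
proof -
  obtain R R' where R: "R \<in> alg_polys \<A>" "R' \<in> alg_polys \<A>"
    "\<And>x. h x * Fraction_Field.Fract q 1 = Fraction_Field.Fract (R x) 1"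
    "\<And>x. h' x * Fraction_Field.Fract q 1 = Fraction_Field.Fract (R' x) 1"
    using assms by (auto simp: clears_def)
  have "(h x + h' x) * Fraction_Field.Fract q 1 = Fraction_Field.Fract (R x + R' x) 1" for x
    by (simp add: distrib_right R)
  then show ?thesis
    using assms(2) by (auto simp: clears_def intro!: bexI[OF _ alg_polys_add[OF alg R(1,2)]])
qed

text \<open>The denominator of each tensor summand comes from its factor in K(\<epsilon>) and is
  free of \<open>x\<close>; the product of these finitely many denominators clears the sum.\<close>

lemma clears_alg_eps:
  assumes K: "number_field K" and alg: "function_algebra K U \<A>" and "h \<in> alg_eps K \<A>"
  shows "\<exists>q. clears K \<A> q h"
proof -
  have "\<exists>q. clears K \<A> q (\<lambda>x. \<Sum>i<m. rat_const (a i x) * f i)"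
    if "\<forall>i<m. a i \<in> \<A> \<and> f i \<in> ratfuns K" for m a and f :: "nat \<Rightarrow> complex poly fract"
    using that
  proof (induction m)
    case 0
    have "(\<lambda>x. 0) \<in> \<A>"
      using function_algebra_sum[OF K alg, of "{}"] by simp
    then have "(\<lambda>x. 0) \<in> alg_polys \<A>"
      by (simp add: alg_polys_def)
    then have "clears K \<A> 1 (\<lambda>x. 0)"
      using number_field_closed(1,2)[OF K] unfolding clears_def
      by (auto simp: coeff_pCons Zero_fract_def split: nat.splits intro!: bexI[of _ "\<lambda>x. 0"])
    then show ?case by auto
  next
    case (Suc m)
    then obtain q where q: "clears K \<A> q (\<lambda>x. \<Sum>i<m. rat_const (a i x) * f i)"
      by auto
    have am: "a m \<in> \<A>"
      using Suc.prems by auto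
    obtain u v where uv: "f m = Fraction_Field.Fract u v" "v \<noteq> 0" "\<forall>i. coeff u i \<in> K" "\<forall>i. coeff v i \<in> K"
      using Suc.prems by (fastforce simp: ratfuns_def)
    have "(\<lambda>x. coeff u i * a m x) \<in> \<A>" for i
      using uv am by (intro function_algebraD[OF alg]) auto
    then have "(\<lambda>x. smult (a m x) u) \<in> alg_polys \<A>"
      by (auto simp: alg_polys_def mult.commute intro!: exI[of _ "Suc (degree u)"] coeff_eq_0)
    moreover have "rat_const (a m x) * f m * Fraction_Field.Fract v 1
        = Fraction_Field.Fract (smult (a m x) u) 1" for x
      using uv by (simp add: rat_const_def eq_fract)
    ultimately have v: "clears K \<A> v (\<lambda>x. rat_const (a m x) * f m)"
      using uv unfolding clears_def by (auto intro!: bexI[of _ "\<lambda>x. smult (a m x) u"])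
    have "clears K \<A> (q * v) (\<lambda>x. (\<Sum>i<m. rat_const (a i x) * f i) + rat_const (a m x) * f m)"
    proof (rule clears_add[OF alg])
      show "clears K \<A> (q * v) (\<lambda>x. \<Sum>i<m. rat_const (a i x) * f i)"
        using v by (intro clears_mult[OF K alg q]) (auto simp: clears_def)
      have "clears K \<A> (v * q) (\<lambda>x. rat_const (a m x) * f m)"
        using q by (intro clears_mult[OF K alg v]) (auto simp: clears_def)
      then show "clears K \<A> (q * v) (\<lambda>x. rat_const (a m x) * f m)"
        by (simp add: mult.commute)
    qed
    then show ?case by auto
  qed
  then show ?thesis
    using assms(3) by (auto simp: alg_eps_def)
qed

lemma common_denominator:
  assumes K: "number_field K" and alg: "function_algebra K U \<A>"
    and "finite F" "F \<subseteq> alg_eps K \<A>"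
  shows "\<exists>q. q \<noteq> 0 \<and> (\<forall>i. coeff q i \<in> K) \<and> (\<forall>h\<in>F. clears K \<A> q h)"
  using assms(3,4)
proof (induction F rule: finite_induct)
  case empty
  then show ?case
    using number_field_closed(1,2)[OF K]
    by (intro exI[of _ 1]) (auto simp: coeff_pCons split: nat.splits)
next
  case (insert h F)
  then obtain q where q: "q \<noteq> 0" "\<forall>i. coeff q i \<in> K" "\<forall>h\<in>F. clears K \<A> q h"
    by fast
  obtain v where v: "clears K \<A> v h"
    using clears_alg_eps[OF K alg, of h] insert by auto
  then have v': "v \<noteq> 0" "\<forall>i. coeff v i \<in> K"
    by (auto simp: clears_def)
  have "clears K \<A> (q * v) g" if "g \<in> insert h F" for g
    using that q v v' clears_mult[OF K alg, of q g v] clears_mult[OF K alg v, of q]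
    by (auto simp: mult.commute)
  then show ?case
    using q v' coeff_mult_closed[OF K] by (intro exI[of _ "q * v"]) auto
qed

text \<open>The value is read off from some fraction s/t with t nonzero at \<open>e\<close>,
  possibly unrelated to \<open>q\<close>. Cross-multiplication gives a polynomial identity to
  evaluate, so zeros of \<open>q\<close> do no harm.\<close>

lemma rat_value_clears:
  assumes "rat_value h e v" "h * Fraction_Field.Fract q 1 = Fraction_Field.Fract r 1"
  shows "poly r e = poly q e * v"
proof -
  obtain s t where st: "poly t e \<noteq> 0" "h = Fraction_Field.Fract s t" "v = poly s e / poly t e"
    using assms(1) by (auto simp: rat_value_def)
  have "t \<noteq> 0"
    using st by auto
  then have "s * q = r * t"
    using assms(2) st by (simp add: eq_fract)
  then have "poly s e * poly q e = poly r e * poly t e"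
    by (metis poly_mult)
  then show ?thesis
    using st(1) by (simp add: st(3) field_simps)
qed

subsection \<open>The differential equation\<close>

lemma bounded_linear_axis: "bounded_linear (axis l :: complex \<Rightarrow> complex^'r::finite)"
  unfolding linear_conv_bounded_linear[symmetric]
  by (simp add: linear_iff vec_eq_iff axis_def)

lemma has_differential_line:
  assumes "has_differential f w x"
  shows "((\<lambda>z. f (x + axis l z)) has_field_derivative w $ l) (at 0)"
proof -
  have "((\<lambda>z. x + axis l z) has_derivative axis l) (at (0::complex))"
    by (auto intro!: derivative_eq_intros bounded_linear_imp_has_derivative[OF bounded_linear_axis])
  moreover have "(f has_derivative (\<lambda>h. \<Sum>k\<in>UNIV. w $ k * h $ k)) (at (x + axis l 0))"
    using assms by (simp add: has_differential_def axis_def zero_vec_def[symmetric])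
  ultimately have "((\<lambda>z. f (x + axis l z)) has_derivative (\<lambda>z. \<Sum>k\<in>UNIV. w $ k * axis l z $ k)) (at 0)"
    by (rule has_derivative_compose)
  moreover have "(\<Sum>k\<in>UNIV. w $ k * axis l z $ k) = w $ l * z" for z
    by (simp add: axis_def if_distrib if_distribR cong: if_cong)
  ultimately show ?thesis
    by (simp add: has_field_derivative_def)
qed

text \<open>\<open>pd\<close> is built from \<open>deriv\<close>, which is a genuine derivative only
  where one exists; on \<open>U\<close> the algebra guarantees existence.\<close>

lemma has_derivative_pd:
  assumes alg: "function_algebra K U \<A>" and "f \<in> \<A>" "x \<in> U"
  shows "((\<lambda>z. f (x + axis l z)) has_field_derivative pd U l f x) (at 0)"
proof -
  obtain w where "has_differential f w x"
    using function_algebraD(2)[OF alg] assms by blast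
  from has_differential_line[OF this, of l] show ?thesis
    using assms(3) DERIV_imp_deriv[OF has_differential_line[OF \<open>has_differential f w x\<close>, of l]]
    by (simp add: pd_def)
qed

text \<open>This lets identities known only on \<open>U\<close> be differentiated along coordinate
  lines.\<close>

lemma eventually_axis_mem:
  fixes U :: "(complex^'r::finite) set"
  assumes "open U" "x \<in> U"
  shows "\<forall>\<^sub>F z in nhds 0. x + axis l z \<in> U"
proof -
  have "((\<lambda>z. x + axis l z) \<longlongrightarrow> x + axis l 0) (nhds (0::complex))"
    by (intro tendsto_intros bounded_linear.tendsto[OF bounded_linear_axis] filterlim_ident)
  then show ?thesis
    using assms topological_tendstoD by (fastforce simp: axis_def zero_vec_def[symmetric])
qed

text \<open>The form df is d(f/1), hence exact in the sense of the C-form condition. If it also lies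
  in the span of the entries of \<open>A\<close>, it is zero, and the constants of the algebra are
  \<open>K\<close>.\<close>

lemma exact_form_const:
  fixes f :: "complex^'r::finite \<Rightarrow> complex"
  assumes K: "number_field K" and alg: "function_algebra K U \<A>" and C: "C_form K U \<A> A"
    and f: "f \<in> \<A>" and df: "(\<lambda>x. \<chi> l. pd U l f x) \<in> entry_space K A"
  shows "f \<in> const_on U ` K"
proof -
  let ?\<omega> = "\<lambda>x. \<chi> l. pd U l f x"
  let ?one = "const_on U 1"
  have K01: "0 \<in> K" "1 \<in> K"
    using number_field_closed[OF K] by auto
  have one: "?one \<in> \<A>" "pd U l ?one = (\<lambda>x. 0)" for l
    using function_algebraD(7,8)[OF alg K01(2)] by auto
  have one_mult: "(\<lambda>x. ?one x * g x) = g" "(\<lambda>x. g x * ?one x) = g" if "g \<in> \<A>" for g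
    using function_algebraD(1)[OF alg that] by (auto simp: const_on_def)
  \<comment> \<open>The denominator 1 is regular because multiplying by it returns the same formal
    sum.\<close>
  have "tensor_mult [(1, ?one)] w = w" if "w \<in> tensors \<A>" for w
    using that by (auto simp: tensor_mult_def tensors_def one_mult intro!: map_idI)
  then have reg: "tensor_regular K \<A> [(1, ?one)]"
    by (auto simp: tensor_regular_def)
  have zero: "(\<lambda>x. 0) \<in> \<A>"
    using function_algebraD(7)[OF alg K01(1)] by (simp add: const_on_def)
  \<comment> \<open>With v = 1 the term u dv is a tensor with second factor 0, which every bilinear
    map kills.\<close>
  have "\<beta> c (\<lambda>x. 0) = 0" if "bilinear_over K \<A> \<beta>" for \<beta> :: "complex \<Rightarrow> (complex^'r \<Rightarrow> complex) \<Rightarrow> complex" and c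
  proof -
    have "\<forall>\<kappa>\<in>K. \<forall>c. \<forall>a\<in>\<A>. \<beta> c (\<lambda>x. \<kappa> * a x) = \<kappa> * \<beta> c a"
      using that by (simp add: bilinear_over_def)
    from this[rule_format, OF K01(1) zero, of c] show ?thesis by simp
  qed
  then have "tensor_eq K \<A>
      (tensor_mult (tensor_mult [(1, ?one)] [(1, ?one)]) [(1, \<lambda>x. ?\<omega> x $ l)]
        @ tensor_mult [(1, f)] (tensor_pd U l [(1, ?one)]))
      (tensor_mult [(1, ?one)] (tensor_pd U l [(1, f)]))" for l
    using one one_mult[OF one(1)] one_mult[OF function_algebraD(5)[OF alg f, of l]]
    by (simp add: tensor_eq_def tensor_mult_def tensor_pd_def)
  then have "?\<omega> \<in> exact_one_forms K U \<A>"
    using f one(1) reg function_algebraD(5)[OF alg f]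
    unfolding exact_one_forms_def
    by (intro CollectI conjI allI bexI[of _ "[(1, f)]"] bexI[of _ "[(1, ?one)]"])
      (auto simp: tensors_def)
  with df C have "?\<omega> = (\<lambda>x. 0)"
    unfolding C_form_def by blast
  then have "pd U l f = (\<lambda>x. 0)" for l
    by (metis (mono_tags, lifting) vec_lambda_beta zero_index)
  then show ?thesis
    using function_algebraD(6)[OF alg f] by blast
qed

text \<open>For a family of polynomials varying with \<open>x\<close>, the uniform bound
  \<open>m\<close> replaces the varying degree, so that the sum can be differentiated term by
  term.\<close>

lemma poly_eq_bounded_sum:
  assumes "\<forall>k\<ge>m. coeff p k = (0::'a::comm_semiring_1)"
  shows "poly p e = (\<Sum>k<m. coeff p k * e ^ k)"
proof -
  have "poly p e = (\<Sum>k\<le>degree p. coeff p k * e ^ k)"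
    by (rule poly_altdef)
  also have "\<dots> = (\<Sum>k\<in>{..degree p} \<union> {..<m}. coeff p k * e ^ k)"
    by (intro sum.mono_neutral_left) (auto simp: coeff_eq_0)
  also have "\<dots> = (\<Sum>k<m. coeff p k * e ^ k)"
    using assms by (intro sum.mono_neutral_right) auto
  finally show ?thesis .
qed

lemma polys_eq_if_infinitely_often:
  fixes p q :: "complex poly"
  assumes "infinite E" "\<And>e. e \<in> E \<Longrightarrow> poly p e = poly q e"
  shows "p = q"
proof (rule ccontr)
  assume "p \<noteq> q"
  then have "finite {e. poly (p - q) e = 0}"
    by (intro poly_roots_finite) simp
  moreover have "E \<subseteq> {e. poly (p - q) e = 0}"
    using assms(2) by auto
  ultimately show False
    using assms(1) finite_subset by blast
qed

lemma triple_product_nth: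
  "(X ** B ** transpose Y) $ i $ j = (\<Sum>b\<in>UNIV. (\<Sum>a\<in>UNIV. X $ i $ a * B $ a $ b) * Y $ j $ b)"
  by (simp add: matrix_matrix_mult_def transpose_def)

text \<open>The factor \<open>B\<close> of R = G B Gd^T is independent of \<open>x\<close>, so the
  product rule gives dR = \<epsilon> (A R + R Ad^T) for each \<epsilon> in \<open>E\<close>. Both
  sides are polynomials in \<epsilon>, and \<open>E\<close> is infinite.\<close>

lemma coefficient_equation:
  fixes A Ad :: "('r::finite one_form, 'n::finite) sq_matrix"
    and G Gd :: "complex^'r \<Rightarrow> complex \<Rightarrow> (complex, 'n) sq_matrix"
    and R :: "'n \<Rightarrow> 'n \<Rightarrow> complex^'r \<Rightarrow> complex poly"
  assumes U: "open U" and x: "x \<in> U" and alg: "function_algebra K U \<A>" and E: "infinite E"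
    and R: "\<And>i j. R i j \<in> alg_polys \<A>"
    and dG: "\<And>\<epsilon> i j. \<epsilon> \<in> E \<Longrightarrow> has_differential (\<lambda>y. G y \<epsilon> $ i $ j)
        (\<epsilon> *s (\<Sum>l\<in>UNIV. G x \<epsilon> $ l $ j *s (A $ i $ l) x)) x"
    and dGd: "\<And>\<epsilon> i j. \<epsilon> \<in> E \<Longrightarrow> has_differential (\<lambda>y. Gd y \<epsilon> $ i $ j)
        (\<epsilon> *s (\<Sum>l\<in>UNIV. Gd x \<epsilon> $ l $ j *s (Ad $ i $ l) x)) x"
    and val: "\<And>y \<epsilon> i j. y \<in> U \<Longrightarrow> \<epsilon> \<in> E \<Longrightarrow>
        poly (R i j y) \<epsilon> = (G y \<epsilon> ** B \<epsilon> ** transpose (Gd y \<epsilon>)) $ i $ j"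
  shows "pd U l (\<lambda>y. coeff (R i j y) k) x = (case k of 0 \<Rightarrow> 0 | Suc k' \<Rightarrow>
      \<Sum>m\<in>UNIV. (A $ i $ m) x $ l * coeff (R m j x) k' + (Ad $ j $ m) x $ l * coeff (R i m x) k')"
proof -
  obtain b where b: "\<forall>y. \<forall>k\<ge>b. coeff (R i j y) k = 0"
    using R[of i j] by (auto simp: alg_polys_def)
  \<comment> \<open>\<open>D\<close> is coordinate \<open>l\<close> of dR, and \<open>T\<close> that
    of A R + R Ad^T. The equation becomes D = \<epsilon> T, that is \<open>pCons 0 T\<close>, which
    causes the index shift in the conclusion.\<close>
  define D where "D = (\<Sum>k<b. monom (pd U l (\<lambda>y. coeff (R i j y) k) x) k)"
  define T where "T = (\<Sum>m\<in>UNIV. smult ((A $ i $ m) x $ l) (R m j x) + smult ((Ad $ j $ m) x $ l) (R i m x))"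
  have RA: "(\<lambda>y. coeff (R i j y) k) \<in> \<A>" for k
    using R by (auto simp: alg_polys_def)
  have "D = pCons 0 T"
  proof (rule polys_eq_if_infinitely_often[OF E])
    fix e assume e: "e \<in> E"
    let ?Al = "\<chi> i m. (A $ i $ m) x $ l" and ?Adl = "\<chi> i m. (Ad $ i $ m) x $ l"
    let ?G = "G x e" and ?Gd = "Gd x e"
    have g: "((\<lambda>z. G (x + axis l z) e $ i $ j) has_field_derivative (mat e ** ?Al ** ?G) $ i $ j) (at 0)" for i j
      using has_differential_line[OF dG[OF e], of l i j]
      by (simp add: mat_mult_left matrix_matrix_mult_def[of ?Al] mult.commute flip: matrix_mul_assoc)
    have gd: "((\<lambda>z. Gd (x + axis l z) e $ i $ j) has_field_derivative (mat e ** ?Adl ** ?Gd) $ i $ j) (at 0)" for i j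
      using has_differential_line[OF dGd[OF e], of l i j]
      by (simp add: mat_mult_left matrix_matrix_mult_def[of ?Adl] mult.commute flip: matrix_mul_assoc)
    have zero: "x + axis l 0 = x"
      by (simp add: axis_def zero_vec_def[symmetric])
    have "((\<lambda>z. (G (x + axis l z) e ** B e ** transpose (Gd (x + axis l z) e)) $ i $ j) has_field_derivative
        (mat e ** ?Al ** ?G ** B e ** transpose ?Gd + ?G ** B e ** transpose (mat e ** ?Adl ** ?Gd)) $ i $ j) (at 0)"
      by (auto simp: triple_product_nth zero sum.distrib intro!: derivative_eq_intros g gd)
        (simp add: mult.commute)
    \<comment> \<open>\<open>val\<close> holds on \<open>U\<close> only, which suffices since the
      line stays in \<open>U\<close> near 0.\<close>
    then have "((\<lambda>z. poly (R i j (x + axis l z)) e) has_field_derivative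
        (mat e ** ?Al ** ?G ** B e ** transpose ?Gd + ?G ** B e ** transpose (mat e ** ?Adl ** ?Gd)) $ i $ j) (at 0)"
      using eventually_axis_mem[OF U x, of l] val[OF _ e]
      by (subst DERIV_cong_ev[OF HOL.refl _ HOL.refl]) (auto elim: eventually_mono)
    moreover have "((\<lambda>z. poly (R i j (x + axis l z)) e) has_field_derivative poly D e) (at 0)"
    proof -
      have "poly (R i j y) e = (\<Sum>k<b. coeff (R i j y) k * e ^ k)" for y
        using b by (intro poly_eq_bounded_sum) auto
      moreover have "poly D e = (\<Sum>k<b. pd U l (\<lambda>y. coeff (R i j y) k) x * e ^ k)"
        by (simp add: D_def poly_sum poly_monom)
      ultimately show ?thesis
        by (auto intro!: DERIV_sum DERIV_cmult_right has_derivative_pd[OF alg RA x])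
    qed
    ultimately have "poly D e = (mat e ** ?Al ** ?G ** B e ** transpose ?Gd + ?G ** B e ** transpose (mat e ** ?Adl ** ?Gd)) $ i $ j"
      by (rule DERIV_unique[rotated])
    \<comment> \<open>Both terms are regrouped around G B Gd^T, whose entries are values of
      \<open>R\<close> by \<open>val\<close>.\<close>
    also have "mat e ** ?Al ** ?G ** B e ** transpose ?Gd = mat e ** (?Al ** (?G ** B e ** transpose ?Gd))"
      by (simp only: matrix_mul_assoc)
    also have "?G ** B e ** transpose (mat e ** ?Adl ** ?Gd)
        = mat e ** ((?G ** B e ** transpose ?Gd) ** transpose ?Adl)"
      by (simp add: matrix_transpose_mul matrix_mul_assoc matrix_mult_mat[of _ e])
    finally have "poly D e = e * ((?Al ** (?G ** B e ** transpose ?Gd)) $ i $ j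
        + ((?G ** B e ** transpose ?Gd) ** transpose ?Adl) $ i $ j)"
      by (simp add: mat_mult_left distrib_left)
    moreover have "(?Al ** W) $ i $ j = (\<Sum>m\<in>UNIV. (A $ i $ m) x $ l * W $ m $ j)"
      "(W ** transpose ?Adl) $ i $ j = (\<Sum>m\<in>UNIV. (Ad $ j $ m) x $ l * W $ i $ m)" for W
      by (simp_all add: matrix_matrix_mult_def transpose_def mult.commute)
    ultimately show "poly D e = poly (pCons 0 T) e"
      by (simp add: T_def poly_sum val[OF x e] sum.distrib)
  qed
  moreover have "coeff D k = pd U l (\<lambda>y. coeff (R i j y) k) x" for k
  proof (cases "k < b")
    case True
    then show ?thesis
      by (simp add: D_def coeff_sum coeff_monom)
  next
    case False
    then show ?thesis
      using b by (simp add: D_def coeff_sum coeff_monom pd_def)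
  qed
  ultimately have "pd U l (\<lambda>y. coeff (R i j y) k) x = coeff (pCons 0 T) k"
    by metis
  then show ?thesis
    by (simp add: coeff_pCons T_def coeff_sum split: nat.split)
qed

text \<open>Once coefficient k is constant, the equation exhibits the differential of coefficient
  k+1 as a \<open>K\<close>-combination of entries of \<open>A\<close>, so
  \<open>exact_form_const\<close> applies. The induction starts from the vanishing differential of
  coefficient 0.\<close>

lemma coefficients_const:
  fixes A :: "('r::finite one_form, 'n::finite) sq_matrix"
    and R :: "'n \<Rightarrow> 'n \<Rightarrow> complex^'r \<Rightarrow> complex poly"
  assumes K: "number_field K" and alg: "function_algebra K U \<A>" and C: "C_form K U \<A> A"
    and A: "\<And>i j. A $ i $ j \<in> closed_one_forms U \<A>"
    and R: "\<And>i j. R i j \<in> alg_polys \<A>"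
    and eq: "\<And>x l i j k. x \<in> U \<Longrightarrow> pd U l (\<lambda>y. coeff (R i j y) k) x = (case k of 0 \<Rightarrow> 0 | Suc k' \<Rightarrow>
      \<Sum>m\<in>UNIV. (A $ i $ m) x $ l * coeff (R m j x) k' - (A $ j $ m) x $ l * coeff (R i m x) k')"
  shows "(\<lambda>x. coeff (R i j x) k) \<in> const_on U ` K"
proof (induction k arbitrary: i j)
  have RA: "(\<lambda>y. coeff (R i j y) k) \<in> \<A>" for i j k
    using R by (auto simp: alg_polys_def)
  {
    case 0
    have "pd U l (\<lambda>y. coeff (R i j y) 0) = (\<lambda>x. 0)" for l
      using eq[where k = 0] by (auto simp: pd_def)
    then show ?case
      by (intro function_algebraD(6)[OF alg RA])
  next
    case (Suc k)
    have "\<forall>i j. \<exists>c. c \<in> K \<and> (\<lambda>x. coeff (R i j x) k) = const_on U c"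
      using Suc by blast
    then obtain c where c: "\<And>i j. c i j \<in> K" "\<And>i j. (\<lambda>x. coeff (R i j x) k) = const_on U (c i j)"
      unfolding choice_iff by blast
    have R_eq: "coeff (R i j x) k = c i j" if "x \<in> U" for x i j
      using c(2)[of i j] that by (metis const_on_def)
    have A0: "(A $ a $ b) x = 0" if "x \<notin> U" for x a b
      using function_algebraD(1)[OF alg _ that] A[of a b]
      by (auto simp: closed_one_forms_def vec_eq_iff)
    \<comment> \<open>\<open>d a b\<close> is the coefficient of the entry \<open>A $ a $ b\<close>
      in A c - c A^T at position (i, j); the first term uses row \<open>i\<close> of
      \<open>A\<close>, the second row \<open>j\<close>.\<close>
    define d where "d a b = (if a = i then c b j else 0) - (if a = j then c i b else 0)" for a b
    have "(\<chi> l. pd U l (\<lambda>y. coeff (R i j y) (Suc k)) x)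
        = (\<Sum>(a, b)\<in>UNIV. d a b *s (A $ a $ b) x)" for x
    proof (cases "x \<in> U")
      case True
      have "(\<Sum>(a, b)\<in>UNIV. d a b *s (A $ a $ b) x) = (\<Sum>b\<in>UNIV. \<Sum>a\<in>UNIV. d a b *s (A $ a $ b) x)"
        by (subst sum.swap) (simp add: sum.cartesian_product)
      also have "\<dots> = (\<Sum>b\<in>UNIV. c b j *s (A $ i $ b) x - c i b *s (A $ j $ b) x)"
        by (simp add: d_def vector_ssub_ldistrib vec_eq_iff left_diff_distrib sum_subtractf
            if_distrib[of "\<lambda>u. u * _"] cong: if_cong)
      finally show ?thesis
        using True by (simp add: vec_eq_iff eq R_eq mult.commute)
    next
      case False
      then show ?thesis
        by (simp add: A0 pd_def vec_eq_iff case_prod_unfold)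
    qed
    moreover have "d a b \<in> K" for a b
      using c(1) number_field_closed[OF K] by (auto simp: d_def)
    ultimately have "(\<lambda>x. \<chi> l. pd U l (\<lambda>y. coeff (R i j y) (Suc k)) x) \<in> entry_space K A"
      by (auto simp: entry_space_def form_span_def case_prod_unfold intro!: exI[of _ "\<lambda>(a, b). d a b"])
    then show ?case
      by (intro exact_form_const[OF K alg C RA])
  }
qed

subsection \<open>Intertwiners of the representation and its transpose\<close>

lemma lie_class_cong:
  assumes "number_field K" "lie_eq K p s s'"
  shows "lie_class K p R s = lie_class K p R s'"
proof -
  have "-1 \<in> K"
    using number_field_closed[OF assms(1)] by blast
  then have "lie_eq K p (LMinus s t) (LMinus s' t)" if "t \<in> lie_exprs K p" for t
    using that assms(2) by (intro lie_eq.cong_add lie_eq.refl lie_exprs.intros)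
  then show ?thesis
    unfolding lie_class_def by (blast intro: lie_ideal.eq lie_eq.sym)
qed

text \<open>Matrices commuting with \<open>X\<close> are closed under sums, scalar multiples and
  commutators, so the generators decide.\<close>

lemma representation_commute:
  assumes K: "number_field K" and \<rho>: "lie_representation K p R \<rho>"
    and gen: "\<And>i. i < p \<Longrightarrow> X ** \<rho> (lie_class K p R (Gen i)) = \<rho> (lie_class K p R (Gen i)) ** X"
    and Y: "Y \<in> lie_quotient K p R"
  shows "X ** \<rho> Y = \<rho> Y ** X"
proof -
  let ?r = "\<lambda>s. \<rho> (lie_class K p R s)"
  have "X ** ?r s = ?r s ** X" if "s \<in> lie_exprs K p" for s
    using that
  proof induction
    case 2
    \<comment> \<open>Additivity applied to 0 + 0 = 0 forces the image of zero to be the zero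
      matrix.\<close>
    have "lie_class K p R (LAdd LZero LZero) = lie_class K p R LZero"
      using K by (intro lie_class_cong lie_eq.add_zero lie_exprs.intros)
    then have "?r LZero = ?r LZero + ?r LZero"
      using \<rho> lie_exprs.intros(2)[of K p] unfolding lie_representation_def by metis
    then show ?case by simp
  next
    case (3 s t)
    then have "?r (LAdd s t) = ?r s + ?r t"
      using \<rho> unfolding lie_representation_def by blast
    with 3 show ?case
      by (simp add: vec_eq_iff matrix_matrix_mult_def distrib_left distrib_right sum.distrib)
  next
    case (4 c s)
    then have "?r (LScale c s) = mat c ** ?r s"
      using \<rho> unfolding lie_representation_def by blast
    then show ?case
      using 4 by (metis matrix_mul_assoc matrix_mult_mat)
  next
    case (5 s t)
    then have r: "?r (LBracket s t) = ?r s ** ?r t - ?r t ** ?r s"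
      using \<rho> unfolding lie_representation_def by blast
    have "X ** (?r u ** ?r v) = (?r u ** ?r v) ** X"
      if "X ** ?r u = ?r u ** X" "X ** ?r v = ?r v ** X" for u v
      using that by (metis matrix_mul_assoc)
    with 5 have "X ** (?r s ** ?r t) = (?r s ** ?r t) ** X" "X ** (?r t ** ?r s) = (?r t ** ?r s) ** X"
      by blast+
    then show ?case
      unfolding r by (simp add: vec_eq_iff matrix_matrix_mult_def left_diff_distrib right_diff_distrib sum_subtractf)
  qed (fact gen)
  then show ?thesis
    using Y by (auto simp: lie_quotient_def)
qed

text \<open>Expanding \<open>A\<close> in the forms \<open>\<omega> k\<close> reduces the identity
  to a comparison of coefficients. Independence is over \<open>K\<close> only, which is why
  \<open>N\<close> must have entries in \<open>K\<close>.\<close>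

lemma intertwiner_of_forms:
  fixes A :: "('r::finite one_form, 'n::finite) sq_matrix" and N :: "(complex, 'n) sq_matrix"
  assumes K: "number_field K" and indep: "form_indep K \<omega> {..<p}"
    and As: "\<And>k i j. k < p \<Longrightarrow> As k $ i $ j \<in> K" "\<And>i j x. (A $ i $ j) x = (\<Sum>k<p. As k $ i $ j *s \<omega> k x)"
    and N: "\<And>i j. N $ i $ j \<in> K"
    and eq: "\<And>i j x. (\<Sum>m\<in>UNIV. N $ m $ j *s (A $ i $ m) x) = (\<Sum>m\<in>UNIV. N $ i $ m *s (A $ j $ m) x)"
    and k: "k < p"
  shows "As k ** N = N ** transpose (As k)"
proof -
  have "(As k ** N - N ** transpose (As k)) $ i $ j = 0" for i j
  proof -
    have "(\<Sum>k<p. (As k ** N) $ i $ j *s \<omega> k x) = (\<Sum>m\<in>UNIV. N $ m $ j *s (A $ i $ m) x)" for x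
      by (simp add: As(2) vec_eq_iff matrix_matrix_mult_def sum_distrib_left sum_distrib_right
          sum.swap[of _ "{..<p}"] mult.commute mult.left_commute)
    moreover have "(\<Sum>k<p. (N ** transpose (As k)) $ i $ j *s \<omega> k x) = (\<Sum>m\<in>UNIV. N $ i $ m *s (A $ j $ m) x)" for x
      by (simp add: As(2) vec_eq_iff matrix_matrix_mult_def transpose_def sum_distrib_left sum_distrib_right
          sum.swap[of _ "{..<p}"] mult.commute mult.left_commute)
    ultimately have "(\<Sum>k<p. (As k ** N - N ** transpose (As k)) $ i $ j *s \<omega> k x) = 0" for x
      by (simp add: vector_sub_rdistrib sum_subtractf eq)
    moreover have "(As k ** N - N ** transpose (As k)) $ i $ j \<in> K" if "k < p" for k
      using As(1)[OF that] N
      by (auto simp: matrix_matrix_mult_def transpose_def intro!: number_field_closed(5,6)[OF K] number_field_sum[OF K])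
    ultimately show ?thesis
      using indep[unfolded form_indep_def, rule_format, of "\<lambda>k. (As k ** N - N ** transpose (As k)) $ i $ j" k] k
      by blast
  qed
  then show ?thesis
    by (simp add: vec_eq_iff)
qed

text \<open>For a generator image B one has B X Y^-1 = X B^T Y^-1 = X Y^-1 B, so X Y^-1 is scalar by
  Schur's lemma.\<close>

lemma intertwiners_proportional:
  fixes \<rho> :: "lie_expr set \<Rightarrow> (complex, 'n::{finite,linorder}) sq_matrix"
  assumes K: "number_field K" and \<rho>: "lie_representation K p R \<rho>"
    and irr: "irreducible_rep (lie_quotient K p R) \<rho>"
    and X: "\<And>i. i < p \<Longrightarrow> \<rho> (lie_class K p R (Gen i)) ** X = X ** transpose (\<rho> (lie_class K p R (Gen i)))"
    and Y: "\<And>i. i < p \<Longrightarrow> \<rho> (lie_class K p R (Gen i)) ** Y = Y ** transpose (\<rho> (lie_class K p R (Gen i)))"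
    and inv: "invertible Y"
  obtains c where "X = mat c ** Y"
proof -
  let ?Z = "matrix_inv Y"
  have "(X ** ?Z) ** \<rho> (lie_class K p R (Gen i)) = \<rho> (lie_class K p R (Gen i)) ** (X ** ?Z)"
    if "i < p" for i
  proof -
    let ?B = "\<rho> (lie_class K p R (Gen i))"
    have "?Z ** ?B = ?Z ** (?B ** Y) ** ?Z"
      by (simp add: matrix_mul_assoc[symmetric] matrix_inv_cancel[OF inv])
    also have "\<dots> = transpose ?B ** ?Z"
      by (simp add: Y[OF that] matrix_mul_assoc matrix_inv_cancel[OF inv])
    finally show ?thesis
      by (metis X[OF that] matrix_mul_assoc)
  qed
  then obtain c where "X ** ?Z = mat c"
    using schur[OF irr representation_commute[OF K \<rho>]] by metis
  then have "X = mat c ** Y"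
    by (metis matrix_inv_cancel(1)[OF inv] matrix_mul_assoc matrix_mul_rid)
  then show thesis
    by (rule that)
qed

section \<open>The intersection matrix of an irreducible system\<close>

theorem theorem3:
  fixes K :: "complex set"
    and U :: "(complex^'r) set"
    and E :: "complex set"
    and \<A> :: "(complex^'r \<Rightarrow> complex) set"
    and n :: int
    and P Pd S Sd C G Gd ::
      "complex^'r \<Rightarrow> complex \<Rightarrow> (complex, 'n::{finite,linorder}) sq_matrix"
    and H :: "complex \<Rightarrow> (complex, 'n) sq_matrix"
    and A Ad :: "('r one_form, 'n) sq_matrix"
    and \<Delta> :: "complex^'r \<Rightarrow> (complex poly fract, 'n) sq_matrix"
    and p q :: nat
    and \<omega> :: "nat \<Rightarrow> 'r one_form"
    and \<eta> :: "nat \<Rightarrow> 'r two_form"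
    and a :: "nat \<Rightarrow> nat \<Rightarrow> nat \<Rightarrow> complex"
    and As :: "nat \<Rightarrow> (complex, 'n) sq_matrix"
    and \<rho> :: "lie_expr set \<Rightarrow> (complex, 'n) sq_matrix"
  assumes K: "number_field K"
    and U: "open U" "connected U" "U \<noteq> {}"
    and E: "open E" "E \<noteq> {}" "\<And>\<epsilon>. \<epsilon> \<in> E \<Longrightarrow> -\<epsilon> \<in> E"
    and alg: "function_algebra K U \<A>"
    and period_matrices: "\<And>x \<epsilon>. x \<in> U \<Longrightarrow> \<epsilon> \<in> E \<Longrightarrow> invertible (P x \<epsilon>) \<and> invertible (Pd x \<epsilon>)"
    and cohomology_intersection: "\<And>x \<epsilon>. x \<in> U \<Longrightarrow> \<epsilon> \<in> E \<Longrightarrow> invertible (C x \<epsilon>)"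
      "\<And>\<epsilon> i j. \<epsilon> \<in> E \<Longrightarrow> rational_on U (\<lambda>x. C x \<epsilon> $ i $ j)"
    and homology_intersection: "\<And>\<epsilon>. \<epsilon> \<in> E \<Longrightarrow> invertible (H \<epsilon>)"
    and bilinear_relation: "\<And>x \<epsilon>. x \<in> U \<Longrightarrow> \<epsilon> \<in> E \<Longrightarrow>
      mat ((2 * of_real pi * \<i>) powi (-n))
        ** P x \<epsilon> ** transpose (matrix_inv (H \<epsilon>)) ** transpose (Pd x \<epsilon>) = C x \<epsilon>"
    and dual_periods: "\<And>x \<epsilon>. x \<in> U \<Longrightarrow> \<epsilon> \<in> E \<Longrightarrow> Pd x \<epsilon> = P x (-\<epsilon>)"
    and canonical_bases: "\<And>x \<epsilon>. x \<in> U \<Longrightarrow> \<epsilon> \<in> E \<Longrightarrow> invertible (S x \<epsilon>) \<and> invertible (Sd x \<epsilon>)"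
      "\<And>x \<epsilon>. x \<in> U \<Longrightarrow> \<epsilon> \<in> E \<Longrightarrow> G x \<epsilon> = matrix_inv (S x \<epsilon>) ** P x \<epsilon>"
      "\<And>x \<epsilon>. x \<in> U \<Longrightarrow> \<epsilon> \<in> E \<Longrightarrow> Gd x \<epsilon> = matrix_inv (Sd x \<epsilon>) ** Pd x \<epsilon>"
    and canonical_equation: "\<And>x \<epsilon> i j. x \<in> U \<Longrightarrow> \<epsilon> \<in> E \<Longrightarrow>
      has_differential (\<lambda>y. G y \<epsilon> $ i $ j)
        (\<epsilon> *s (\<Sum>l\<in>UNIV. G x \<epsilon> $ l $ j *s (A $ i $ l) x)) x"
    and dual_canonical_equation: "\<And>x \<epsilon> i j. x \<in> U \<Longrightarrow> \<epsilon> \<in> E \<Longrightarrow>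
      has_differential (\<lambda>y. Gd y \<epsilon> $ i $ j)
        (\<epsilon> *s (\<Sum>l\<in>UNIV. Gd x \<epsilon> $ l $ j *s (Ad $ i $ l) x)) x"
    and closed_entries: "\<And>i j. A $ i $ j \<in> closed_one_forms U \<A>"
      "\<And>i j. Ad $ i $ j \<in> closed_one_forms U \<A>"
    and integrable: "wedge_square_zero A" "wedge_square_zero Ad"
    and dual_connection: "\<And>i j x. (Ad $ i $ j) x = - (A $ i $ j) x"
    and C_form: "C_form K U \<A> A" "C_form K U \<A> Ad"
    and \<Delta>: "in_GL_eps K U \<A> \<Delta>"
      "\<And>x \<epsilon> i j. x \<in> U \<Longrightarrow> \<epsilon> \<in> E \<Longrightarrow>
        rat_value (\<Delta> x $ i $ j) \<epsilon>
          ((matrix_inv (S x \<epsilon>) ** C x \<epsilon> ** transpose (matrix_inv (Sd x \<epsilon>))) $ i $ j)"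
    and \<omega>_basis: "form_indep K \<omega> {..<p}" "form_span K \<omega> {..<p} = entry_space K A"
    and As: "\<And>k i j. k < p \<Longrightarrow> As k $ i $ j \<in> K"
      "\<And>i j x. (A $ i $ j) x = (\<Sum>k<p. As k $ i $ j *s \<omega> k x)"
    and \<eta>: "\<And>k. k < q \<Longrightarrow> \<eta> k \<in> closed_two_forms U \<A>" "form_indep K \<eta> {..<q}"
    and a: "\<And>i j k. i < p \<Longrightarrow> j < p \<Longrightarrow> k < q \<Longrightarrow> a i j k \<in> K"
      "\<And>i j x. i < p \<Longrightarrow> j < p \<Longrightarrow> wedge (\<omega> i) (\<omega> j) x = (\<Sum>k<q. a i j k *s \<eta> k x)"
    and \<rho>: "lie_representation K p (quadratic_relators p q a) \<rho>"
      "\<And>i. i < p \<Longrightarrow> \<rho> (lie_class K p (quadratic_relators p q a) (Gen i)) = As i"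
    and self_dual: "self_dual (lie_quotient K p (quadratic_relators p q a)) \<rho>"
    and irreducible: "irreducible_rep (lie_quotient K p (quadratic_relators p q a)) \<rho>"
  shows "\<exists>f \<Delta>\<^sub>0. f \<in> ratfuns K \<and>
           (\<forall>i j. \<Delta>\<^sub>0 $ i $ j \<in> K) \<and> invertible \<Delta>\<^sub>0 \<and>
           (transpose \<Delta>\<^sub>0 = \<Delta>\<^sub>0 \<or> transpose \<Delta>\<^sub>0 = - \<Delta>\<^sub>0) \<and>
           (\<forall>x\<in>U. \<forall>i j. \<Delta> x $ i $ j = f * rat_const (\<Delta>\<^sub>0 $ i $ j))"
proof -
  let ?L = "lie_quotient K p (quadratic_relators p q a)"
  note Kc = number_field_closed[OF K]
  have "finite (range (\<lambda>(i, j) x. \<Delta> x $ i $ j))" "range (\<lambda>(i, j) x. \<Delta> x $ i $ j) \<subseteq> alg_eps K \<A>"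
    using \<Delta>(1) by (auto simp: in_GL_eps_def)
  from common_denominator[OF K alg this] obtain Q where Q: "Q \<noteq> 0" "\<forall>i. coeff Q i \<in> K"
    "\<And>i j. clears K \<A> Q (\<lambda>x. \<Delta> x $ i $ j)"
    by fast
  then obtain R where R: "\<And>i j. R i j \<in> alg_polys \<A>"
    "\<And>i j x. \<Delta> x $ i $ j * Fraction_Field.Fract Q 1 = Fraction_Field.Fract (R i j x) 1"
    unfolding clears_def by metis
  define I where "I x \<epsilon> = matrix_inv (S x \<epsilon>) ** C x \<epsilon> ** transpose (matrix_inv (Sd x \<epsilon>))" for x \<epsilon>
  have R_val: "poly (R i j x) \<epsilon> = poly Q \<epsilon> * I x \<epsilon> $ i $ j" if "x \<in> U" "\<epsilon> \<in> E" for x \<epsilon> i j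
    using rat_value_clears[OF \<Delta>(2)[OF that] R(2)] by (simp add: I_def)
  \<comment> \<open>All factors of R that do not depend on \<open>x\<close>: the cleared
    denominator, the power of 2 pi i and the homology intersection matrix.\<close>
  define B where "B \<epsilon> = mat (poly Q \<epsilon> * (2 * of_real pi * \<i>) powi (-n)) ** transpose (matrix_inv (H \<epsilon>))" for \<epsilon>
  have R_GG: "poly (R i j x) \<epsilon> = (G x \<epsilon> ** B \<epsilon> ** transpose (Gd x \<epsilon>)) $ i $ j" if "x \<in> U" "\<epsilon> \<in> E" for x \<epsilon> i j
  proof -
    let ?c = "(2 * of_real pi * \<i>) powi (-n)"
    have "I x \<epsilon> = matrix_inv (S x \<epsilon>) ** (mat ?c ** P x \<epsilon> ** transpose (matrix_inv (H \<epsilon>)) ** transpose (Pd x \<epsilon>))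
        ** transpose (matrix_inv (Sd x \<epsilon>))"
      unfolding I_def bilinear_relation[OF that] ..
    also have "\<dots> = mat ?c ** (G x \<epsilon> ** transpose (matrix_inv (H \<epsilon>)) ** transpose (Gd x \<epsilon>))"
      unfolding canonical_bases(2,3)[OF that]
      by (simp add: matrix_transpose_mul matrix_mul_assoc matrix_mult_mat[of _ ?c])
    finally show ?thesis
      unfolding R_val[OF that] B_def
      by (simp add: matrix_mul_assoc matrix_mult_mat[of "G x \<epsilon>"])
        (simp add: mat_mult_left flip: matrix_mul_assoc)
  qed
  have E_inf: "infinite E"
    using E finite_imp_not_open by blast
  \<comment> \<open>Substituting Ad = -A turns A R + R Ad^T into A R - R A^T.\<close>
  have "pd U l (\<lambda>y. coeff (R i j y) k) x = (case k of 0 \<Rightarrow> 0 | Suc k' \<Rightarrow>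
      \<Sum>m\<in>UNIV. (A $ i $ m) x $ l * coeff (R m j x) k' - (A $ j $ m) x $ l * coeff (R i m x) k')"
    if x: "x \<in> U" for x l i j k
    using coefficient_equation[OF U(1) x alg E_inf R(1) canonical_equation[OF x] dual_canonical_equation[OF x] R_GG]
    by (simp add: dual_connection split: nat.split)
  note pd_R = this
  have "(\<lambda>x. coeff (R i j x) k) \<in> const_on U ` K" for i j k
    by (rule coefficients_const[OF K alg C_form(1) closed_entries(1) R(1) pd_R])
  then have "\<forall>i j k. \<exists>c. c \<in> K \<and> (\<lambda>x. coeff (R i j x) k) = const_on U c"
    by blast
  then obtain c where c: "\<And>i j k. c i j k \<in> K" "\<And>i j k. (\<lambda>x. coeff (R i j x) k) = const_on U (c i j k)"
    unfolding choice_iff by blast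
  have R_c: "coeff (R i j x) k = c i j k" if "x \<in> U" for x i j k
    using c(2)[of i j k] that by (metis const_on_def)
  define N :: "nat \<Rightarrow> (complex, 'n) sq_matrix" where "N k = (\<chi> i j. c i j k)" for k
  have N_K: "N k $ i $ j \<in> K" for i j k
    by (simp add: N_def c)
  \<comment> \<open>Coefficient k+1 is constant too, so its equation reads A N_k = N_k A^T.\<close>
  have N_int: "As l ** N k = N k ** transpose (As l)" if "l < p" for k l
  proof (rule intertwiner_of_forms[OF K \<omega>_basis(1) As N_K _ that])
    fix i j x
    show "(\<Sum>m\<in>UNIV. N k $ m $ j *s (A $ i $ m) x) = (\<Sum>m\<in>UNIV. N k $ i $ m *s (A $ j $ m) x)"
    proof (cases "x \<in> U")
      case True
      have "pd U l (\<lambda>y. coeff (R i j y) (Suc k)) x = 0" for l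
        using function_algebraD(8)[OF alg c(1)] by (simp add: c(2))
      then show ?thesis
        using pd_R[OF True, of _ i j "Suc k"]
        by (simp add: R_c[OF True] N_def vec_eq_iff sum_subtractf mult.commute)
    next
      case False
      then have "(A $ a $ b) x = 0" for a b
        using function_algebraD(1)[OF alg _ False] closed_entries(1)[of a b]
        by (auto simp: closed_one_forms_def vec_eq_iff)
      then show ?thesis by simp
    qed
  qed
  obtain x\<^sub>0 where x0: "x\<^sub>0 \<in> U"
    using U by blast
  \<comment> \<open>A single coefficient \<open>N k\<close> might be singular. The value of R at a
    point where \<open>Q\<close> does not vanish is invertible, and provides the solution to compare
    with.\<close>
  have "\<not> E \<subseteq> {\<epsilon>. poly Q \<epsilon> = 0}"
    using E_inf poly_roots_finite[OF Q(1)] finite_subset by blast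
  then obtain e where e: "e \<in> E" "poly Q e \<noteq> 0"
    by blast
  define Y where "Y = mat (poly Q e) ** I x\<^sub>0 e"
  have Y_poly: "Y $ i $ j = poly (R i j x\<^sub>0) e" for i j
    by (simp add: Y_def mat_mult_left R_val[OF x0 e(1)])
  have "mat (poly Q e) ** mat (1 / poly Q e) = (mat 1 :: (complex, 'n) sq_matrix)"
    using e by (simp add: vec_eq_iff mat_mult_left) (simp add: mat_def)
  then have "invertible (mat (poly Q e) :: (complex, 'n) sq_matrix)"
    by (auto simp: invertible_right_inverse)
  then have Y_inv: "invertible Y"
    unfolding Y_def I_def
    using cohomology_intersection(1)[OF x0 e(1)] canonical_bases(1)[OF x0 e(1)]
    by (intro invertible_mult invertible_transpose invertible_matrix_inv) auto
  \<comment> \<open>\<open>Y\<close> is the finite sum of the \<open>N k\<close> times powers of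
    \<open>e\<close>, and the intertwining relation is linear.\<close>
  have Y_int: "As l ** Y = Y ** transpose (As l)" if "l < p" for l
  proof -
    obtain b where "\<forall>i j. \<forall>k\<ge>b. coeff (R i j x\<^sub>0) k = 0"
    proof (rule that, intro allI impI)
      fix i j k assume "Max (range (\<lambda>(i, j). Suc (degree (R i j x\<^sub>0)))) \<le> k"
      moreover have "Suc (degree (R i j x\<^sub>0)) \<le> Max (range (\<lambda>(i, j). Suc (degree (R i j x\<^sub>0))))"
        by (intro Max_ge) auto
      ultimately show "coeff (R i j x\<^sub>0) k = 0"
        by (intro coeff_eq_0) linarith
    qed
    then have Y: "Y $ i $ j = (\<Sum>k<b. N k $ i $ j * e ^ k)" for i j
      using poly_eq_bounded_sum[of b "R i j x\<^sub>0" e] by (simp add: Y_poly R_c[OF x0] N_def)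
    have "(As l ** Y) $ i $ j = (\<Sum>k<b. (As l ** N k) $ i $ j * e ^ k)" for i j
      by (simp add: matrix_matrix_mult_def Y sum_distrib_left sum_distrib_right sum.swap[of _ "{..<b}"] mult.assoc)
    moreover have "(Y ** transpose (As l)) $ i $ j = (\<Sum>k<b. (N k ** transpose (As l)) $ i $ j * e ^ k)" for i j
      by (simp add: matrix_matrix_mult_def Y sum_distrib_left sum_distrib_right sum.swap[of _ "{..<b}"] mult_ac)
    ultimately show ?thesis
      by (simp add: vec_eq_iff N_int[OF that])
  qed
  have ratio: "\<exists>c. X = mat c ** Z"
    if "\<And>l. l < p \<Longrightarrow> As l ** X = X ** transpose (As l)" "\<And>l. l < p \<Longrightarrow> As l ** Z = Z ** transpose (As l)" "invertible Z"
    for X Z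
    using intertwiners_proportional[OF K \<rho>(1) irreducible, of X Z] that by (metis \<rho>(2))
  then have "\<exists>c. N k = mat c ** Y" for k
    using ratio N_int Y_int Y_inv by blast
  then obtain d where d: "\<And>k. N k = mat (d k) ** Y"
    by metis
  have "Y \<noteq> 0"
  proof
    assume "Y = 0"
    then show False
      using matrix_inv_cancel(2)[OF Y_inv]
      by (simp add: vec_eq_iff matrix_matrix_mult_def mat_def) (metis one_neq_zero)
  qed
  then obtain i\<^sub>0 j\<^sub>0 where "Y $ i\<^sub>0 $ j\<^sub>0 \<noteq> 0"
    by (auto simp: vec_eq_iff)
  then have "R i\<^sub>0 j\<^sub>0 x\<^sub>0 \<noteq> 0"
    by (auto simp: Y_poly)
  then obtain k\<^sub>0 where "coeff (R i\<^sub>0 j\<^sub>0 x\<^sub>0) k\<^sub>0 \<noteq> 0"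
    by (meson leading_coeff_0_iff)
  then have k0: "N k\<^sub>0 $ i\<^sub>0 $ j\<^sub>0 \<noteq> 0"
    by (simp add: R_c[OF x0] N_def)
  \<comment> \<open>A coefficient matrix is chosen instead of \<open>Y\<close>, because the entries
    of \<open>Y\<close> involve the complex number \<open>e\<close> and need not lie in
    \<open>K\<close>. As a nonzero multiple of \<open>Y\<close> it is still invertible.\<close>
  define D where "D = N k\<^sub>0"
  have D0: "D $ i\<^sub>0 $ j\<^sub>0 \<noteq> 0"
    by (simp add: D_def k0)
  then have "d k\<^sub>0 \<noteq> 0"
    using d[of k\<^sub>0] by (auto simp: D_def mat_mult_left)
  then have "mat (d k\<^sub>0) ** mat (1 / d k\<^sub>0) = (mat 1 :: (complex, 'n) sq_matrix)"
    by (simp add: vec_eq_iff mat_mult_left) (simp add: mat_def)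
  then have D_inv: "invertible D"
    unfolding D_def d using Y_inv
    by (intro invertible_mult) (auto simp: invertible_right_inverse)
  have D_int: "As l ** D = D ** transpose (As l)" if "l < p" for l
    using N_int that by (simp add: D_def)
  \<comment> \<open>Transposing A D = D A^T gives the same relation for the transpose of
    \<open>D\<close>.\<close>
  have "As l ** transpose D = transpose D ** transpose (As l)" if "l < p" for l
    using D_int[OF that] by (metis matrix_transpose_mul transpose_transpose)
  then obtain s where s: "transpose D = mat s ** D"
    using ratio D_int D_inv by blast
  have s_nth: "D $ j $ i = s * D $ i $ j" for i j
  proof -
    have "transpose D $ i $ j = s * D $ i $ j"
      by (simp only: s mat_mult_left)
    then show ?thesis by (simp add: transpose_def)
  qed
  \<comment> \<open>Transposing twice, read off at a nonzero entry.\<close>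
  have "D $ i\<^sub>0 $ j\<^sub>0 = s * (s * D $ i\<^sub>0 $ j\<^sub>0)"
    by (subst s_nth, subst s_nth) (rule HOL.refl)
  then have "s * s = 1"
    using D0 by (simp flip: mult.assoc)
  then have "s = 1 \<or> s = -1"
    by (simp add: square_eq_1_iff)
  moreover have "mat (-1) ** D = - D"
    by (simp add: vec_eq_iff mat_mult_left)
  ultimately have sym: "transpose D = D \<or> transpose D = - D"
    using s by auto
  \<comment> \<open>The common scalar factor of R = r D, found from the entry where \<open>D\<close>
    is nonzero; f is then r/Q.\<close>
  define r where "r = smult (1 / D $ i\<^sub>0 $ j\<^sub>0) (R i\<^sub>0 j\<^sub>0 x\<^sub>0)"
  have r_K: "\<forall>k. coeff r k \<in> K"
    using c(1) N_K Kc by (auto simp: r_def R_c[OF x0] D_def)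
  have R_r: "R i j x = smult (D $ i $ j) r" if "x \<in> U" for i j x
  proof (rule poly_eqI)
    fix k
    \<comment> \<open>Both matrices are multiples of \<open>Y\<close>, so their entries satisfy this
      cross relation.\<close>
    have "N k $ i $ j * D $ i\<^sub>0 $ j\<^sub>0 = D $ i $ j * N k $ i\<^sub>0 $ j\<^sub>0"
      by (simp add: D_def d mat_mult_left)
    then show "coeff (R i j x) k = coeff (smult (D $ i $ j) r) k"
      using D0 by (simp add: r_def R_c[OF that] R_c[OF x0] N_def field_simps)
  qed
  have "\<Delta> x $ i $ j = Fraction_Field.Fract r Q * rat_const (D $ i $ j)" if "x \<in> U" for x i j
  proof -
    have Q0: "Fraction_Field.Fract Q 1 \<noteq> 0"
      using Q(1) by (simp add: Zero_fract_def eq_fract)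
    have "Fraction_Field.Fract r Q * rat_const (D $ i $ j) * Fraction_Field.Fract Q 1
        = Fraction_Field.Fract (R i j x) 1"
      using Q(1) by (simp add: R_r[OF that] rat_const_def eq_fract)
    then show ?thesis
      using Q0 R(2)[of x i j] by (metis mult_right_cancel)
  qed
  moreover have "Fraction_Field.Fract r Q \<in> ratfuns K"
    using r_K Q by (auto simp: ratfuns_def)
  ultimately show ?thesis
    using N_K D_inv sym by (intro exI[of _ "Fraction_Field.Fract r Q"] exI[of _ D]) (auto simp: D_def)
qed

end
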